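(* Let $\sigma$ be the measure on $\mathbb{R}^3$ given by $\sigma(y,t)=\delta(t-|y|^2-|y|^4)\,dy\,dt$, $(y,t)\in\mathbb{R}^{2+1}$, let $w(y)=(1+|y|^2)^{1/2}$, and let $\mathcal S$ be the optimal (smallest) constant in the inequality $$\|f\sqrt w\,\sigma\ast f\sqrt w\,\sigma\|_{L^2(\mathbb{R}^3)}\leq\mathcal S^2\|f\|_{L^2(\mathbb{R}^2)}^2,\qquad f\in L^2(\mathbb{R}^2).\qquad(\ast)$$ Then $\mathcal S^4=\frac{\pi}{2}$. Moreover, extremizers for inequality $(\ast)$ do not exist, and extremizing sequences for $(\ast)$ concentrate at the origin.
   Context: The measure $\sigma$ is defined by $\int g\,d\sigma=\int_{\mathbb{R}^2}g(y,|y|^2+|y|^4)\,dy$; $h\sigma$ is the measure $\int g\,d(h\sigma)=\int_{\mathbb{R}^2}g(y,|y|^2+|y|^4)h(y)\,dy$; convolutions are identified with their Lebesgue densities. An extremizer is a nonzero $f\in L^2(\mathbb{R}^2)$ giving equality in $(\ast)$. An extremizing sequence is a sequence $\{f_n\}\subset L^2(\mathbb{R}^2)$ with $\|f_n\|_{L^2}\leq1$ and $\|f_n\sqrt w\sigma\ast f_n\sqrt w\sigma\|_{L^2(\mathbb{R}^3)}\to\mathcal S^2$. A sequence $\{f_n\}$ concentrates at the origin if for every $\varepsilon,\rho>0$ there is $N$ such that $\int_{\{|y|\geq\rho\}}|f_n|^2\,dy<\varepsilon\|f_n\|_{L^2}^2$ for all $n\geq N$. *)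

theory Defs
  imports "HOL-Analysis.Analysis"
begin

text \<open>
  \<open>\<real>\<^sup>2\<close> is \<^typ>\<open>real^2\<close> and \<open>\<real>\<^sup>3 = \<real>\<^sup>2 \<times> \<real>\<close> is \<^typ>\<open>(real^2) \<times> real\<close>, with the product Lebesgue
  measure. An element of \<open>L\<^sup>2\<close> is given by a Borel measurable, complex-valued representative.
\<close>

definition L2_fun :: "('a::euclidean_space \<Rightarrow> complex) set" where
  "L2_fun = {f \<in> borel_measurable lborel. integrable lborel (\<lambda>x. (cmod (f x))\<^sup>2)}"

definition L2_norm :: "('a::euclidean_space \<Rightarrow> complex) \<Rightarrow> real" where
  "L2_norm f = sqrt (LINT x|lborel. (cmod (f x))\<^sup>2)"

definition \<sigma> :: "((real^2) \<times> real) measure" where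
  "\<sigma> = distr lborel borel (\<lambda>y. (y, (norm y)^2 + (norm y)^4))"

lemma integral_sigma:
  fixes g :: "(real^2) \<times> real \<Rightarrow> complex"
  assumes "g \<in> borel_measurable borel"
  shows "(LINT p|\<sigma>. g p) = (LINT y|lborel. g (y, (norm y)^2 + (norm y)^4))"
  unfolding \<sigma>_def by (rule integral_distr) (use assms in \<open>auto intro!: borel_measurable_Pair\<close>)

definition w :: "real^2 \<Rightarrow> real" where
  "w y = (1 + (norm y)^2) powr (1/2)"

text \<open>
  \<open>F\<close> is a Lebesgue density of the convolution \<open>h\<sigma> \<ast> k\<sigma>\<close>. For \<open>f \<in> L\<^sup>2\<close> the function \<open>f \<surd>w\<close> is only
  locally integrable, so \<open>h\<sigma>\<close> and \<open>h\<sigma> \<ast> k\<sigma>\<close> are in general complex measures on bounded Borel sets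
  only; hence the restriction to bounded test sets. The left-hand integral is
  \<open>(h\<sigma> \<ast> k\<sigma>)(B)\<close>, the integral of \<open>1\<^sub>B(p + q)\<close> against \<open>h\<sigma> \<otimes> k\<sigma>\<close>.
\<close>
definition conv_density ::
    "(real^2 \<Rightarrow> complex) \<Rightarrow> (real^2 \<Rightarrow> complex) \<Rightarrow> ((real^2) \<times> real \<Rightarrow> complex) \<Rightarrow> bool" where
  "conv_density h k F \<longleftrightarrow>
     F \<in> borel_measurable lborel \<and>
     (\<forall>B \<in> sets borel. bounded B \<longrightarrow>
        set_integrable lborel B F \<and>
        has_bochner_integral (\<sigma> \<Otimes>\<^sub>M \<sigma>)
          (\<lambda>(p, q). indicator B (p + q) * (h (fst p) * k (fst q)))
          (LINT x:B|lborel. F x))"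

text \<open>
  \<open>F\<close> is the density of \<open>f \<surd>w \<sigma> \<ast> f \<surd>w \<sigma>\<close> and lies in \<open>L\<^sup>2(\<real>\<^sup>3)\<close>; such an \<open>F\<close> is unique up to null sets,
  so its \<open>L\<^sup>2\<close> norm depends on \<open>f\<close> only.
\<close>
definition weighted_self_conv :: "(real^2 \<Rightarrow> complex) \<Rightarrow> ((real^2) \<times> real \<Rightarrow> complex) \<Rightarrow> bool" where
  "weighted_self_conv f F \<longleftrightarrow>
     F \<in> L2_fun \<and>
     conv_density (\<lambda>y. f y * complex_of_real (sqrt (w y))) (\<lambda>y. f y * complex_of_real (sqrt (w y))) F"

definition conv_inequality :: "real \<Rightarrow> bool" where
  "conv_inequality C \<longleftrightarrow>
     (\<forall>f \<in> L2_fun. \<exists>F. weighted_self_conv f F \<and> L2_norm F \<le> C\<^sup>2 * (L2_norm f)\<^sup>2)"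

definition best_const :: real where
  "best_const = Inf {C. 0 \<le> C \<and> conv_inequality C}"

definition extremizer :: "(real^2 \<Rightarrow> complex) \<Rightarrow> bool" where
  "extremizer f \<longleftrightarrow>
     f \<in> L2_fun \<and> \<not> (AE y in lborel. f y = 0) \<and>
     (\<exists>F. weighted_self_conv f F \<and> L2_norm F = best_const\<^sup>2 * (L2_norm f)\<^sup>2)"

definition extremizing_seq :: "(nat \<Rightarrow> real^2 \<Rightarrow> complex) \<Rightarrow> bool" where
  "extremizing_seq f \<longleftrightarrow>
     (\<forall>n. f n \<in> L2_fun \<and> L2_norm (f n) \<le> 1) \<and>
     (\<exists>F. (\<forall>n. weighted_self_conv (f n) (F n)) \<and> (\<lambda>n. L2_norm (F n)) \<longlonglongrightarrow> best_const\<^sup>2)"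

definition concentrates_at_origin :: "(nat \<Rightarrow> real^2 \<Rightarrow> complex) \<Rightarrow> bool" where
  "concentrates_at_origin f \<longleftrightarrow>
     (\<forall>\<epsilon>>0. \<forall>\<rho>>0. \<exists>N. \<forall>n\<ge>N.
        (LINT y:{y. \<rho> \<le> norm y}|lborel. (cmod (f n y))\<^sup>2) < \<epsilon> * (L2_norm (f n))\<^sup>2)"

end

theory Submission
  imports Defs
begin

text \<open>
  Let \<open>T(y, y') = (y + y', \<psi>(y) + \<psi>(y'))\<close> with \<open>\<psi>(y) = |y|\<^sup>2 + |y|\<^sup>4\<close>, so that \<open>f\<surd>w\<sigma> \<ast> f\<surd>w\<sigma>\<close> is the push-forward
  under \<open>T\<close> of \<open>H dy dy'\<close>, \<open>H = f(y) f(y') \<surd>(w(y) w(y'))\<close>. For the explicit weight \<open>J = jac\<close> the push-forward of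
  \<open>J dy dy'\<close> is exactly \<open>\<pi>\<close> times Lebesgue measure on the range of \<open>T\<close>. Duality and Cauchy--Schwarz,
  with \<open>H = (H / \<surd>J) \<surd>J\<close>, then bound the squared \<open>L\<^sup>2\<close> norm of the convolution by
  \<open>\<pi> \<integral> |H|\<^sup>2 / J dy dy'\<close>. Writing \<open>s = |y|\<^sup>2 + |y'|\<^sup>2\<close> one has \<open>J \<ge> 2 + 2s\<close> and \<open>w(y) w(y') \<le> 1 + s/2\<close>, hence
  \<open>w(y) w(y') / J \<le> (1 - s / (2 (1 + s))) / 2\<close>. This is below \<open>1/2\<close> away from the origin, which gives
  \<open>\<S>\<^sup>4 \<le> \<pi>/2\<close>, excludes extremizers, and forces extremizing sequences to concentrate at the origin.
  Sharpness comes from \<open>f = exp (- l \<psi>) / \<surd>w\<close> as \<open>l \<rightarrow> \<infinity>\<close>.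
\<close>

section \<open>Slope coordinates in the plane\<close>

text \<open>The projection rules are stated for product sigma-algebras; rewriting with
  \<open>borel_prod\<close> makes them apply to functions that are measurable into
  \<open>borel\<close> of a product type.\<close>

lemma borel_measurable_fst_snd [measurable (raw)]:
  fixes f :: "'a \<Rightarrow> 'b::second_countable_topology \<times> 'c::second_countable_topology"
  assumes "f \<in> borel_measurable M"
  shows "(\<lambda>x. fst (f x)) \<in> borel_measurable M" "(\<lambda>x. snd (f x)) \<in> borel_measurable M"
  using assms by (simp_all flip: borel_prod)

definition pt :: "real \<Rightarrow> real \<Rightarrow> real^2" where
  "pt x y = x *\<^sub>R axis 1 1 + y *\<^sub>R axis 2 1"

lemma pt_nth [simp]: "pt x y $ 1 = x" "pt x y $ 2 = y"
  by (simp_all add: pt_def axis_def)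

lemma norm_pt_sq: "(norm (pt x y))\<^sup>2 = x\<^sup>2 + y\<^sup>2"
  by (simp add: power2_norm_eq_inner inner_vec_def UNIV_2 flip: power2_eq_square)

lemma inner_pt: "v \<bullet> pt x y = v $ 1 * x + v $ 2 * y"
  by (simp add: inner_vec_def UNIV_2)

lemma measurable_pt [measurable (raw)]:
  assumes [measurable]: "f \<in> borel_measurable M" "g \<in> borel_measurable M"
  shows "(\<lambda>x. pt (f x) (g x)) \<in> borel_measurable M"
  unfolding pt_def by measurable

text \<open>Gives access to Tonelli in coordinates on the vector type. Lebesgue measure is
  determined by boxes, and the preimage of a box under \<open>pt\<close> is a rectangle.\<close>

lemma lborel_eq_distr_pt: "(lborel :: (real^2) measure) = distr lborel borel (\<lambda>p. pt (fst p) (snd p))"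
proof (rule lborel_eqI)
  fix l u :: "real^2"
  assume lu: "\<And>b. b \<in> Basis \<Longrightarrow> l \<bullet> b \<le> u \<bullet> b"
  have le: "l $ i \<le> u $ i" for i
    using lu[of "axis i 1"] by (simp add: inner_axis axis_in_Basis_iff)
  have "(\<lambda>p. pt (fst p) (snd p)) -` box l u \<inter> space lborel = {l$1<..<u$1} \<times> {l$2<..<u$2}"
    by (auto simp: mem_box_cart forall_2)
  then have "emeasure (distr lborel borel (\<lambda>p. pt (fst p) (snd p))) (box l u)
      = emeasure (lborel \<Otimes>\<^sub>M lborel) ({l$1<..<u$1} \<times> {l$2<..<u$2})"
    by (subst emeasure_distr) (auto simp: lborel_prod)
  also have "\<dots> = ennreal ((u$1 - l$1) * (u$2 - l$2))"
    using le by (subst lborel.emeasure_pair_measure_Times) (auto simp: ennreal_mult)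
  also have "(u$1 - l$1) * (u$2 - l$2) = (\<Prod>b\<in>Basis. (u - l) \<bullet> b)"
  proof -
    have B: "Basis = {axis 1 1, axis 2 1 :: real^2}"
      unfolding Basis_vec_def by (simp add: UNION_singleton_eq_range UNIV_2 insert_commute)
    have "axis 1 1 \<noteq> (axis 2 1 :: real^2)" by (simp add: axis_eq_axis)
    then show ?thesis unfolding B by (simp add: inner_axis)
  qed
  finally show "emeasure (distr lborel borel (\<lambda>p. pt (fst p) (snd p))) (box l u) = \<dots>" .
qed simp

text \<open>Slope coordinates \<open>(x, x t)\<close> do the work of polar coordinates.\<close>

lemma nn_integral_slope:
  fixes g :: "real^2 \<Rightarrow> ennreal"
  assumes [measurable]: "g \<in> borel_measurable borel"
  shows "(\<integral>\<^sup>+z. g z \<partial>lborel) = (\<integral>\<^sup>+t. \<integral>\<^sup>+x. ennreal \<bar>x\<bar> * g (pt x (x * t)) \<partial>lborel \<partial>lborel)"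
proof -
  have "(\<integral>\<^sup>+z. g z \<partial>lborel) = (\<integral>\<^sup>+p. g (pt (fst p) (snd p)) \<partial>(lborel \<Otimes>\<^sub>M lborel))"
    by (subst lborel_eq_distr_pt) (simp add: nn_integral_distr lborel_prod)
  also have "\<dots> = (\<integral>\<^sup>+x. \<integral>\<^sup>+y. g (pt x y) \<partial>lborel \<partial>lborel)"
    by (subst lborel.nn_integral_fst[symmetric]) (simp_all add: lborel_prod)
  also have "\<dots> = (\<integral>\<^sup>+x. \<integral>\<^sup>+t. ennreal \<bar>x\<bar> * g (pt x (x * t)) \<partial>lborel \<partial>lborel)"
  proof (rule nn_integral_cong_AE)
    \<comment> \<open>The substitution y = x t degenerates at x = 0, which is a null set.\<close>
    have "AE x in lborel. x \<noteq> (0::real)" by (rule AE_lborel_singleton)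
    then show "AE x in lborel. (\<integral>\<^sup>+y. g (pt x y) \<partial>lborel)
        = (\<integral>\<^sup>+t. ennreal \<bar>x\<bar> * g (pt x (x * t)) \<partial>lborel)"
    proof eventually_elim
      case (elim x)
      then show ?case
        by (subst nn_integral_real_affine[where c=x and t=0]) (auto simp: nn_integral_cmult)
    qed
  qed
  also have "\<dots> = (\<integral>\<^sup>+t. \<integral>\<^sup>+x. ennreal \<bar>x\<bar> * g (pt x (x * t)) \<partial>lborel \<partial>lborel)"
    by (rule lborel_pair.Fubini') measurable
  finally show ?thesis .
qed

section \<open>Integrals in one real variable\<close>

lemma nn_integral_even:
  fixes h :: "real \<Rightarrow> ennreal"
  assumes [measurable]: "h \<in> borel_measurable borel" and even: "\<And>x. h (- x) = h x"
  shows "(\<integral>\<^sup>+x. h x \<partial>lborel) = 2 * (\<integral>\<^sup>+x. h x * indicator {0..} x \<partial>lborel)"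
proof -
  have ae: "AE x in lborel. x \<noteq> (0::real)" by (rule AE_lborel_singleton)
  have "(\<integral>\<^sup>+x. h x \<partial>lborel)
      = (\<integral>\<^sup>+x. h x * indicator {0..} x + h x * indicator {..0} x \<partial>lborel)"
    by (rule nn_integral_cong_AE) (use ae in eventually_elim, auto split: split_indicator)
  also have "\<dots> = (\<integral>\<^sup>+x. h x * indicator {0..} x \<partial>lborel) + (\<integral>\<^sup>+x. h x * indicator {..0} x \<partial>lborel)"
    by (rule nn_integral_add) auto
  also have "(\<integral>\<^sup>+x. h x * indicator {..0} x \<partial>lborel) = (\<integral>\<^sup>+x. h x * indicator {0..} x \<partial>lborel)"
    by (subst nn_integral_real_affine[where c="-1" and t=0])
      (auto simp: even intro!: nn_integral_cong split: split_indicator)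
  finally show ?thesis by (simp add: mult_2)
qed

text \<open>Substitution is known on compact intervals. The half line is exhausted by {a..a + n +
  1}; as g is nondecreasing on it and unbounded, the image intervals exhaust {g a..}, and monotone
  convergence applies on both sides. The \<open>+ 1\<close> keeps the interval nondegenerate for n =
  0.\<close>

lemma nn_integral_substitution_atLeast:
  fixes f :: "real \<Rightarrow> ennreal" and g g' :: "real \<Rightarrow> real"
  assumes [measurable]: "f \<in> borel_measurable borel" "g \<in> borel_measurable borel"
    "g' \<in> borel_measurable borel"
    and derivg: "\<And>x. (g has_real_derivative g' x) (at x)"
    and contg': "continuous_on UNIV g'"
    and nonneg: "\<And>x. a \<le> x \<Longrightarrow> g' x \<ge> 0"
    and lim: "filterlim g at_top at_top"
  shows "(\<integral>\<^sup>+x. f x * indicator {g a..} x \<partial>lborel)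
       = (\<integral>\<^sup>+x. f (g x) * ennreal (g' x) * indicator {a..} x \<partial>lborel)"
proof -
  have mono: "g x \<le> g y" if "a \<le> x" "x \<le> y" for x y
    using that by (intro DERIV_nonneg_imp_nondecreasing[OF that(2)]) (meson derivg nonneg order_trans)
  have "(\<integral>\<^sup>+x. f x * indicator {g a..} x \<partial>lborel)
      = (\<integral>\<^sup>+x. (SUP n::nat. f x * indicator {g a..g (a + real n + 1)} x) \<partial>lborel)"
  proof (rule nn_integral_cong)
    fix x
    obtain N where N: "\<And>y. N \<le> y \<Longrightarrow> x \<le> g y"
      using lim unfolding filterlim_at_top eventually_at_top_linorder by meson
    obtain n::nat where n: "N - a \<le> real n" using real_arch_simple by blast
    have *: "x \<le> g (a + real n + 1)" by (rule N) (use n in simp)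
    show "f x * indicator {g a..} x = (SUP n::nat. f x * indicator {g a..g (a + real n + 1)} x)"
    proof (rule antisym)
      have "f x * indicator {g a..} x \<le> f x * indicator {g a..g (a + real n + 1)} x"
        using * by (auto split: split_indicator)
      also have "\<dots> \<le> (SUP n::nat. f x * indicator {g a..g (a + real n + 1)} x)"
        by (rule SUP_upper) simp
      finally show "f x * indicator {g a..} x \<le> \<dots>" .
    qed (auto intro!: SUP_least split: split_indicator)
  qed
  also have "\<dots> = (SUP n::nat. (\<integral>\<^sup>+x. f x * indicator {g a..g (a + real n + 1)} x \<partial>lborel))"
    by (rule nn_integral_monotone_convergence_SUP)
      (auto simp: incseq_def le_fun_def split: split_indicator intro: order_trans[OF _ mono])
  also have "\<dots> = (SUP n::nat. (\<integral>\<^sup>+x. f (g x) * ennreal (g' x) * indicator {a..a + real n + 1} x \<partial>lborel))"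
    by (intro SUP_cong refl nn_integral_substitution_aux)
      (auto intro: derivg nonneg continuous_on_subset[OF contg'])
  also have "\<dots> = (\<integral>\<^sup>+x. (SUP n::nat. f (g x) * ennreal (g' x) * indicator {a..a + real n + 1} x) \<partial>lborel)"
    by (rule nn_integral_monotone_convergence_SUP[symmetric])
      (auto simp: incseq_def le_fun_def split: split_indicator)
  also have "\<dots> = (\<integral>\<^sup>+x. f (g x) * ennreal (g' x) * indicator {a..} x \<partial>lborel)"
  proof (rule nn_integral_cong)
    fix x
    obtain n::nat where n: "x - a \<le> real n" using real_arch_simple by blast
    show "(SUP n::nat. f (g x) * ennreal (g' x) * indicator {a..a + real n + 1} x)
        = f (g x) * ennreal (g' x) * indicator {a..} x" (is "(SUP n. ?h n) = ?r")
    proof (rule antisym)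
      have "?r \<le> ?h n" using n by (auto split: split_indicator)
      also have "\<dots> \<le> (SUP n. ?h n)" by (rule SUP_upper) simp
      finally show "?r \<le> \<dots>" .
    qed (auto intro!: SUP_least split: split_indicator)
  qed
  finally show ?thesis .
qed

text \<open>The source of the factor pi in the sharp constant: t is the slope, so this is the
  measure of the angles of all lines through the origin.\<close>

lemma nn_integral_inverse_1_plus_sq:
  "(\<integral>\<^sup>+t. ennreal (1 / (1 + t\<^sup>2)) \<partial>lborel) = ennreal pi"
proof -
  have "(\<integral>\<^sup>+t. ennreal (1 / (1 + t\<^sup>2)) * indicator {0..} t \<partial>lborel) = ennreal (pi / 2 - arctan 0)"
  proof (rule nn_integral_FTC_atLeast)
    show "(arctan has_real_derivative 1 / (1 + x\<^sup>2)) (at x)" for x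
      using DERIV_arctan[of x] by (simp add: inverse_eq_divide)
  qed (auto intro: tendsto_arctan_at_top)
  then show ?thesis
    by (subst nn_integral_even) (auto simp: ennreal_mult[symmetric] simp flip: ennreal_numeral)
qed

section \<open>The push-forward identity\<close>

definition phase :: "real^2 \<Rightarrow> real" where
  "phase y = (norm y)\<^sup>2 + (norm y) ^ 4"

definition sum_map :: "(real^2) \<times> (real^2) \<Rightarrow> (real^2) \<times> real" where
  "sum_map p = (fst p + snd p, phase (fst p) + phase (snd p))"

text \<open>
  \<open>jac\<close> is half the derivative of \<open>phase (\<xi>/2 + z) + phase (\<xi>/2 - z)\<close> in \<open>norm z\<close>, divided by \<open>norm z\<close>,
  at \<open>\<xi> = y + y'\<close> and \<open>z = (y - y') / 2\<close>.
  On the null set \<open>y = y'\<close> its last term is the junk value \<open>0\<close>.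
\<close>

definition jac :: "(real^2) \<times> (real^2) \<Rightarrow> real" where
  "jac p = 2 + 2 * ((norm (fst p))\<^sup>2 + (norm (snd p))\<^sup>2)
     + 2 * ((norm (fst p))\<^sup>2 - (norm (snd p))\<^sup>2)\<^sup>2 / (norm (fst p - snd p))\<^sup>2"

text \<open>The threshold is \<open>2 * phase (\<xi> / 2)\<close>, the value of
  \<open>phase y + phase y'\<close> at y = y' = \<xi>/2, which is its minimum under y + y' = \<xi>
  by convexity.\<close>

definition conv_supp :: "((real^2) \<times> real) set" where
  "conv_supp = {q. (norm (fst q))\<^sup>2 / 2 + (norm (fst q)) ^ 4 / 8 \<le> snd q}"

lemma measurable_phase [measurable]: "phase \<in> borel_measurable borel"
  unfolding phase_def by measurable

lemma measurable_sum_map [measurable]: "sum_map \<in> borel_measurable borel"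
  unfolding sum_map_def by (simp flip: borel_prod) 

lemma measurable_jac [measurable]: "jac \<in> borel_measurable borel"
  unfolding jac_def by (simp flip: borel_prod)

lemma measurable_conv_supp [measurable]: "conv_supp \<in> sets borel"
  unfolding conv_supp_def by (intro borel_closed closed_Collect_le continuous_intros) auto

lemma jac_ge: "2 + 2 * ((norm (fst p))\<^sup>2 + (norm (snd p))\<^sup>2) \<le> jac p"
  by (simp add: jac_def)

lemma jac_ge_2: "2 \<le> jac p"
  by (rule order_trans[OF _ jac_ge]) simp

lemma norm_half_add_sq:
  fixes \<xi> z :: "'a::real_inner"
  shows "(norm ((1/2) *\<^sub>R \<xi> + z))\<^sup>2 = (norm \<xi>)\<^sup>2 / 4 + (norm z)\<^sup>2 + \<xi> \<bullet> z"
    and "(norm ((1/2) *\<^sub>R \<xi> - z))\<^sup>2 = (norm \<xi>)\<^sup>2 / 4 + (norm z)\<^sup>2 - \<xi> \<bullet> z"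
  by (simp_all add: power2_norm_eq_inner inner_add inner_diff inner_commute)

text \<open>In centred coordinates the two squared norms are A + b and A - b with
  \<open>b = \<xi> \<bullet> z\<close>, so odd powers of b cancel. Along every line through the
  origin the sum is therefore an even polynomial in the coordinate on the line.\<close>

lemma phase_centered:
  "phase ((1/2) *\<^sub>R \<xi> + z) + phase ((1/2) *\<^sub>R \<xi> - z) =
     2 * ((norm \<xi>)\<^sup>2 / 4 + (norm z)\<^sup>2) + 2 * ((norm \<xi>)\<^sup>2 / 4 + (norm z)\<^sup>2)\<^sup>2 + 2 * (\<xi> \<bullet> z)\<^sup>2"
proof -
  have *: "norm u ^ 4 = ((norm u)\<^sup>2)\<^sup>2" for u :: "real^2" by simp
  have "A + b + (A + b)\<^sup>2 + (A - b + (A - b)\<^sup>2) = 2 * A + 2 * A\<^sup>2 + 2 * b\<^sup>2" for A b :: real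
    by (simp add: power2_eq_square algebra_simps)
  then show ?thesis
    unfolding phase_def * norm_half_add_sq .
qed

lemma jac_centered:
  "jac ((1/2) *\<^sub>R \<xi> + z, (1/2) *\<^sub>R \<xi> - z) =
     2 + 4 * ((norm \<xi>)\<^sup>2 / 4 + (norm z)\<^sup>2) + 2 * (\<xi> \<bullet> z)\<^sup>2 / (norm z)\<^sup>2"
proof -
  have *: "(1/2) *\<^sub>R \<xi> + z - ((1/2) *\<^sub>R \<xi> - z) = 2 *\<^sub>R z" by (simp add: vec_eq_iff)
  show ?thesis
    unfolding jac_def fst_conv snd_conv norm_half_add_sq *
    by (simp add: power_mult_distrib)
qed

text \<open>Here G is the phase sum along the line z = x (1, t), with q = 1 + t^2, p the inner
  product of \<xi> and (1, t), and R = |\<xi>|^2 / 4. The weight is |G'|, so each half line is a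
  substitution starting at \<open>G 0 = 2 * R + 2 * R\<^sup>2\<close>; evenness of G gives the
  factor 2.\<close>

lemma nn_integral_radial:
  fixes \<phi> :: "real \<Rightarrow> ennreal" and p :: real
  assumes [measurable]: "\<phi> \<in> borel_measurable borel" and q: "0 < q" and R: "0 \<le> R"
  defines "G \<equiv> \<lambda>x::real. 2 * (R + x\<^sup>2 * q) + 2 * (R + x\<^sup>2 * q)\<^sup>2 + 2 * (x * p)\<^sup>2"
  shows "(\<integral>\<^sup>+x. \<phi> (G x) * ennreal (\<bar>x\<bar> * (4 * q + 8 * q * (R + x\<^sup>2 * q) + 4 * p\<^sup>2)) \<partial>lborel)
       = 2 * (\<integral>\<^sup>+\<tau>. \<phi> \<tau> * indicator {2 * R + 2 * R\<^sup>2..} \<tau> \<partial>lborel)"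
proof -
  define G' where "G' x = x * (4 * q + 8 * q * (R + x\<^sup>2 * q) + 4 * p\<^sup>2)" for x
  have [measurable]: "G \<in> borel_measurable borel" "G' \<in> borel_measurable borel"
    unfolding G_def G'_def by measurable
  have der: "(G has_real_derivative G' x) (at x)" for x
    unfolding G_def G'_def
    by (auto intro!: derivative_eq_intros simp: power2_eq_square algebra_simps)
  have "filterlim (\<lambda>x. 2 * q * x ^ 2) at_top at_top"
    using q by (intro filterlim_tendsto_pos_mult_at_top[OF tendsto_const] filterlim_pow_at_top) 
      (auto simp: filterlim_ident)
  then have lim: "filterlim G at_top at_top"
  proof (rule filterlim_at_top_mono)
    have "2 * q * x ^ 2 \<le> G x" for x
      using R by (simp add: G_def algebra_simps)
    then show "\<forall>\<^sub>F x in at_top. 2 * q * x ^ 2 \<le> G x" by simp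
  qed
  have "(\<integral>\<^sup>+x. \<phi> (G x) * ennreal (\<bar>x\<bar> * (4 * q + 8 * q * (R + x\<^sup>2 * q) + 4 * p\<^sup>2)) \<partial>lborel)
      = 2 * (\<integral>\<^sup>+x. \<phi> (G x) * ennreal (\<bar>x\<bar> * (4 * q + 8 * q * (R + x\<^sup>2 * q) + 4 * p\<^sup>2)) * indicator {0..} x \<partial>lborel)"
    by (rule nn_integral_even) (measurable, simp add: G_def)
  also have "(\<integral>\<^sup>+x. \<phi> (G x) * ennreal (\<bar>x\<bar> * (4 * q + 8 * q * (R + x\<^sup>2 * q) + 4 * p\<^sup>2)) * indicator {0..} x \<partial>lborel)
      = (\<integral>\<^sup>+x. \<phi> (G x) * ennreal (G' x) * indicator {0..} x \<partial>lborel)"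
    by (rule nn_integral_cong) (simp add: G'_def split: split_indicator)
  also have "\<dots> = (\<integral>\<^sup>+x. \<phi> x * indicator {G 0..} x \<partial>lborel)"
  proof (rule nn_integral_substitution_atLeast[symmetric])
    show "continuous_on UNIV G'" unfolding G'_def by (intro continuous_intros)
    show "0 \<le> G' x" if "0 \<le> x" for x using that q R by (simp add: G'_def)
  qed (use der lim in auto)
  finally show ?thesis by (simp add: G_def)
qed

text \<open>On the line of slope t, |x| times \<open>jac\<close> is the modulus of the derivative of
  the phase sum divided by 2 (1 + t^2). The two half lines together give 1 / (1 + t^2) times an
  integral over \<tau> that does not depend on t, and these factors integrate to pi.\<close>

lemma nn_integral_jac_fiber:
  fixes \<phi> :: "real \<Rightarrow> ennreal" and \<xi> :: "real^2"
  assumes [measurable]: "\<phi> \<in> borel_measurable borel"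
  shows "(\<integral>\<^sup>+z. ennreal (jac ((1/2) *\<^sub>R \<xi> + z, (1/2) *\<^sub>R \<xi> - z))
            * \<phi> (phase ((1/2) *\<^sub>R \<xi> + z) + phase ((1/2) *\<^sub>R \<xi> - z)) \<partial>lborel)
       = ennreal pi * (\<integral>\<^sup>+\<tau>. \<phi> \<tau> * indicator {(norm \<xi>)\<^sup>2 / 2 + norm \<xi> ^ 4 / 8..} \<tau> \<partial>lborel)"
proof -
  define R where "R = (norm \<xi>)\<^sup>2 / 4"
  have R: "0 \<le> R" by (simp add: R_def)
  define I where "I = (\<integral>\<^sup>+\<tau>. \<phi> \<tau> * indicator {2 * R + 2 * R\<^sup>2..} \<tau> \<partial>lborel)"
  have I: "(\<integral>\<^sup>+\<tau>. \<phi> \<tau> * indicator {(norm \<xi>)\<^sup>2 / 2 + norm \<xi> ^ 4 / 8..} \<tau> \<partial>lborel) = I"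
    by (simp add: I_def R_def power2_eq_square numeral_eq_Suc)
  let ?g = "\<lambda>z. ennreal (2 + 4 * (R + (norm z)\<^sup>2) + 2 * (\<xi> \<bullet> z)\<^sup>2 / (norm z)\<^sup>2)
      * \<phi> (2 * (R + (norm z)\<^sup>2) + 2 * (R + (norm z)\<^sup>2)\<^sup>2 + 2 * (\<xi> \<bullet> z)\<^sup>2)"
  have "(\<integral>\<^sup>+z. ?g z \<partial>lborel)
      = (\<integral>\<^sup>+t. \<integral>\<^sup>+x. ennreal \<bar>x\<bar> * ?g (pt x (x * t)) \<partial>lborel \<partial>lborel)"
    by (rule nn_integral_slope) measurable
  also have "\<dots> = (\<integral>\<^sup>+t. ennreal (1 / (1 + t\<^sup>2)) * I \<partial>lborel)"
  proof (rule nn_integral_cong)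
    fix t :: real
    define q where "q = 1 + t\<^sup>2"
    define p where "p = \<xi> $ 1 + \<xi> $ 2 * t"
    have q: "0 < q" by (simp add: q_def add_pos_nonneg)
    have n: "(norm (pt x (x * t)))\<^sup>2 = x\<^sup>2 * q" for x
      by (simp add: norm_pt_sq q_def power_mult_distrib algebra_simps)
    have i: "\<xi> \<bullet> pt x (x * t) = x * p" for x
      by (simp add: inner_pt p_def algebra_simps)
    have swap: "a * (X * f) = c * (f * Y)" if "a * X = c * Y" for a X c Y f :: ennreal
      using that by (metis mult.assoc mult.commute)
    have "ennreal \<bar>x\<bar> * ?g (pt x (x * t))
        = ennreal (1 / (2 * q)) * (\<phi> (2 * (R + x\<^sup>2 * q) + 2 * (R + x\<^sup>2 * q)\<^sup>2 + 2 * (x * p)\<^sup>2)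
            * ennreal (\<bar>x\<bar> * (4 * q + 8 * q * (R + x\<^sup>2 * q) + 4 * p\<^sup>2)))" for x
    proof -
      \<comment> \<open>At x = 0 the quotient takes the default value 0, and the factor |x| makes
        both sides vanish.\<close>
      have "\<bar>x\<bar> * (2 + 4 * (R + x\<^sup>2 * q) + 2 * (x * p)\<^sup>2 / (x\<^sup>2 * q))
          = 1 / (2 * q) * (\<bar>x\<bar> * (4 * q + 8 * q * (R + x\<^sup>2 * q) + 4 * p\<^sup>2))"
        using q by (cases "x = 0") (simp_all add: field_simps)
      moreover have "0 \<le> \<bar>x\<bar> * (4 * q + 8 * q * (R + x\<^sup>2 * q) + 4 * p\<^sup>2)" 
        using q R by (intro mult_nonneg_nonneg add_nonneg_nonneg) auto
      moreover have "0 \<le> 2 + 4 * (R + x\<^sup>2 * q) + 2 * (x * p)\<^sup>2 / (x\<^sup>2 * q)"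
        using q R by (intro add_nonneg_nonneg divide_nonneg_nonneg mult_nonneg_nonneg) auto
      ultimately have "ennreal \<bar>x\<bar> * ennreal (2 + 4 * (R + x\<^sup>2 * q) + 2 * (x * p)\<^sup>2 / (x\<^sup>2 * q))
          = ennreal (1 / (2 * q)) * ennreal (\<bar>x\<bar> * (4 * q + 8 * q * (R + x\<^sup>2 * q) + 4 * p\<^sup>2))"
        using q by (metis abs_ge_zero ennreal_mult divide_nonneg_pos mult_pos_pos zero_less_numeral zero_le_one)
      then show ?thesis
        unfolding n i by (rule swap)
    qed
    then have "(\<integral>\<^sup>+x. ennreal \<bar>x\<bar> * ?g (pt x (x * t)) \<partial>lborel) = ennreal (1 / (2 * q)) * (2 * I)"
      unfolding I_def nn_integral_radial[OF assms q R, of p, symmetric]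
      by (simp only:) (rule nn_integral_cmult, measurable)
    also have "\<dots> = ennreal (1 / (1 + t\<^sup>2)) * I"
    proof -
      have "ennreal (1 / (2 * q)) * 2 = ennreal (1 / (2 * q) * 2)"
        using q by (subst ennreal_mult) auto
      also have "1 / (2 * q) * 2 = 1 / (1 + t\<^sup>2)" using q by (simp flip: q_def)
      finally show ?thesis by (simp add: mult.assoc[symmetric])
    qed
    finally show "(\<integral>\<^sup>+x. ennreal \<bar>x\<bar> * ?g (pt x (x * t)) \<partial>lborel) = ennreal (1 / (1 + t\<^sup>2)) * I" .
  qed
  also have "\<dots> = ennreal pi * I"
    by (simp add: nn_integral_multc nn_integral_inverse_1_plus_sq)
  finally show ?thesis
    unfolding I phase_centered jac_centered R_def .
qed

lemma nn_integral_translate: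
  fixes h :: "'a::euclidean_space \<Rightarrow> ennreal"
  assumes [measurable]: "h \<in> borel_measurable borel"
  shows "(\<integral>\<^sup>+y. h y \<partial>lborel) = (\<integral>\<^sup>+y. h (c + y) \<partial>lborel)"
  by (subst lborel_distr_plus[of c, symmetric]) (simp add: nn_integral_distr)

lemma nn_integral_lborel_pair:
  fixes f :: "'a::euclidean_space \<times> 'b::euclidean_space \<Rightarrow> ennreal"
  assumes "f \<in> borel_measurable borel"
  shows "(\<integral>\<^sup>+p. f p \<partial>lborel) = (\<integral>\<^sup>+x. \<integral>\<^sup>+y. f (x, y) \<partial>lborel \<partial>lborel)"
  using lborel.nn_integral_fst[of f "lborel :: 'a measure"] assms by (simp add: lborel_prod)

text \<open>Disintegration over \<xi> = y + y'. The translations y' = \<xi> - y and y = \<xi>/2 + z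
  preserve Lebesgue measure, the inner integral is the fibre identity, and Tonelli reassembles the
  outer ones.\<close>

lemma nn_integral_jac_sum_map:
  fixes \<phi> :: "(real^2) \<times> real \<Rightarrow> ennreal"
  assumes [measurable]: "\<phi> \<in> borel_measurable borel"
  shows "(\<integral>\<^sup>+p. ennreal (jac p) * \<phi> (sum_map p) \<partial>lborel)
       = ennreal pi * (\<integral>\<^sup>+q. \<phi> q * indicator conv_supp q \<partial>lborel)"
proof -
  have [measurable]: "\<phi> \<in> borel_measurable (borel \<Otimes>\<^sub>M borel)" by (simp add: borel_prod)
  have [measurable]: "jac \<in> borel_measurable (borel \<Otimes>\<^sub>M borel)" by (simp add: borel_prod)
  let ?h = "\<lambda>y y'. ennreal (jac (y, y')) * \<phi> (y + y', phase y + phase y')"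
  have "(\<integral>\<^sup>+p. ennreal (jac p) * \<phi> (sum_map p) \<partial>lborel)
      = (\<integral>\<^sup>+y. \<integral>\<^sup>+y'. ?h y y' \<partial>lborel \<partial>lborel)"
    by (subst nn_integral_lborel_pair) (measurable, simp add: sum_map_def)
  also have "\<dots> = (\<integral>\<^sup>+y. \<integral>\<^sup>+\<xi>. ?h y (\<xi> - y) \<partial>lborel \<partial>lborel)"
  proof (rule nn_integral_cong)
    show "(\<integral>\<^sup>+y'. ?h y y' \<partial>lborel) = (\<integral>\<^sup>+\<xi>. ?h y (\<xi> - y) \<partial>lborel)" for y
      using nn_integral_translate[of "?h y" "- y"] by simp
  qed
  also have "\<dots> = (\<integral>\<^sup>+\<xi>. \<integral>\<^sup>+y. ?h y (\<xi> - y) \<partial>lborel \<partial>lborel)"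
    by (rule lborel_pair.Fubini') measurable
  also have "\<dots> = (\<integral>\<^sup>+\<xi>. \<integral>\<^sup>+z. ?h ((1/2) *\<^sub>R \<xi> + z) ((1/2) *\<^sub>R \<xi> - z) \<partial>lborel \<partial>lborel)"
  proof (rule nn_integral_cong)
    fix \<xi> :: "real^2"
    have [simp]: "\<xi> - ((1/2) *\<^sub>R \<xi> + z) = (1/2) *\<^sub>R \<xi> - z" for z
      by (simp add: vec_eq_iff field_simps)
    show "(\<integral>\<^sup>+y. ?h y (\<xi> - y) \<partial>lborel) = (\<integral>\<^sup>+z. ?h ((1/2) *\<^sub>R \<xi> + z) ((1/2) *\<^sub>R \<xi> - z) \<partial>lborel)"
      by (subst nn_integral_translate[where c="(1/2) *\<^sub>R \<xi>"]) simp_all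
  qed
  also have "\<dots> = (\<integral>\<^sup>+\<xi>. ennreal pi * (\<integral>\<^sup>+\<tau>. \<phi> (\<xi>, \<tau>) * indicator conv_supp (\<xi>, \<tau>) \<partial>lborel) \<partial>lborel)"
  proof (rule nn_integral_cong)
    fix \<xi> :: "real^2"
    have [simp]: "(1/2) *\<^sub>R \<xi> + z + ((1/2) *\<^sub>R \<xi> - z) = \<xi>" for z
      by (simp add: vec_eq_iff field_simps)
    show "(\<integral>\<^sup>+z. ?h ((1/2) *\<^sub>R \<xi> + z) ((1/2) *\<^sub>R \<xi> - z) \<partial>lborel)
        = ennreal pi * (\<integral>\<^sup>+\<tau>. \<phi> (\<xi>, \<tau>) * indicator conv_supp (\<xi>, \<tau>) \<partial>lborel)"
      using nn_integral_jac_fiber[of "\<lambda>\<tau>. \<phi> (\<xi>, \<tau>)" \<xi>]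
      by (simp add: conv_supp_def indicator_def)
  qed
  also have "\<dots> = ennreal pi * (\<integral>\<^sup>+\<xi>. \<integral>\<^sup>+\<tau>. \<phi> (\<xi>, \<tau>) * indicator conv_supp (\<xi>, \<tau>) \<partial>lborel \<partial>lborel)"
    by (rule nn_integral_cmult) (simp add: borel_prod)
  also have "(\<integral>\<^sup>+\<xi>. \<integral>\<^sup>+\<tau>. \<phi> (\<xi>, \<tau>) * indicator conv_supp (\<xi>, \<tau>) \<partial>lborel \<partial>lborel)
      = (\<integral>\<^sup>+q. \<phi> q * indicator conv_supp q \<partial>lborel)"
    by (rule nn_integral_lborel_pair[symmetric]) measurable
  finally show ?thesis .
qed

section \<open>Cauchy--Schwarz and push-forwards\<close>

text \<open>Young's inequality with a free parameter, from (s a - b)^2 / s being nonnegative;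
  optimising s gives Cauchy--Schwarz for extended nonnegative integrals.\<close>

lemma ennreal_two_mult_le:
  fixes x y :: ennreal and s :: real
  assumes s: "0 < s"
  shows "2 * (x * y) \<le> ennreal s * x\<^sup>2 + ennreal (1 / s) * y\<^sup>2"
proof (cases "x = top \<or> y = top")
  case True
  with s show ?thesis by (auto simp: power2_eq_square ennreal_mult_top ennreal_top_mult)
next
  case False
  then obtain a b where ab: "x = ennreal a" "0 \<le> a" "y = ennreal b" "0 \<le> b"
    by (metis ennreal_cases)
  have "0 \<le> (s * a - b)\<^sup>2 / s" using s by simp
  also have "(s * a - b)\<^sup>2 / s = s * a\<^sup>2 + 1 / s * b\<^sup>2 - 2 * (a * b)"
    using s by (simp add: power2_eq_square field_simps)
  finally have "ennreal (2 * (a * b)) \<le> ennreal (s * a\<^sup>2 + 1 / s * b\<^sup>2)"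
    by (intro ennreal_leI) simp
  also have "\<dots> = ennreal s * x\<^sup>2 + ennreal (1 / s) * y\<^sup>2"
    using ab s by (simp add: ennreal_mult[symmetric] ennreal_power ennreal_plus[symmetric] del: ennreal_plus)
  finally show ?thesis
    using ab by (simp add: ennreal_mult)
qed

lemma nn_integral_Cauchy_Schwarz:
  fixes f g :: "'a \<Rightarrow> ennreal"
  assumes [measurable]: "f \<in> borel_measurable M" "g \<in> borel_measurable M"
  shows "(\<integral>\<^sup>+x. f x * g x \<partial>M)\<^sup>2 \<le> (\<integral>\<^sup>+x. (f x)\<^sup>2 \<partial>M) * (\<integral>\<^sup>+x. (g x)\<^sup>2 \<partial>M)"
proof -
  let ?A = "\<integral>\<^sup>+x. (f x)\<^sup>2 \<partial>M" and ?B = "\<integral>\<^sup>+x. (g x)\<^sup>2 \<partial>M"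
  consider "?A = 0 \<or> ?B = 0" | "?A \<noteq> 0" "?B \<noteq> 0" "?A = top \<or> ?B = top"
    | "?A \<noteq> 0" "?B \<noteq> 0" "?A \<noteq> top" "?B \<noteq> top" by blast
  then show ?thesis
  proof cases
    case 1
    then have "(AE x in M. (f x)\<^sup>2 = 0) \<or> (AE x in M. (g x)\<^sup>2 = 0)"
      by (subst (asm) (1 2) nn_integral_0_iff_AE) auto
    then have "AE x in M. f x * g x = 0" by auto
    then have "(\<integral>\<^sup>+x. f x * g x \<partial>M) = 0" by (subst nn_integral_0_iff_AE) auto
    then show ?thesis by simp
  next
    case 2
    then show ?thesis by (auto simp: ennreal_mult_top ennreal_top_mult)
  next
    case 3
    then obtain a b where ab: "?A = ennreal a" "0 < a" "?B = ennreal b" "0 < b"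
      by (metis ennreal_cases ennreal_0 order_le_less)
    \<comment> \<open>The balancing choice: it makes \<open>s * a\<close> and
      \<open>1 / s * b\<close> both equal to \<open>sqrt (a * b)\<close>.\<close>
    define s where "s = sqrt (b / a)"
    have s: "0 < s" using ab by (simp add: s_def)
    have "2 * (\<integral>\<^sup>+x. f x * g x \<partial>M) = (\<integral>\<^sup>+x. 2 * (f x * g x) \<partial>M)"
      by (rule nn_integral_cmult[symmetric]) measurable
    also have "\<dots> \<le> (\<integral>\<^sup>+x. ennreal s * (f x)\<^sup>2 + ennreal (1 / s) * (g x)\<^sup>2 \<partial>M)"
      by (intro nn_integral_mono ennreal_two_mult_le s)
    also have "\<dots> = ennreal s * ?A + ennreal (1 / s) * ?B"
      by (subst nn_integral_add) (auto simp: nn_integral_cmult)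
    also have "\<dots> = ennreal (s * a + 1 / s * b)"
      using ab s by (simp add: ennreal_mult[symmetric] ennreal_plus[symmetric] del: ennreal_plus)
    also have "s * a + 1 / s * b = 2 * sqrt (a * b)"
    proof -
      have "s * a = sqrt (a * b)" "1 / s * b = sqrt (a * b)"
        using ab by (simp_all add: s_def real_sqrt_divide real_sqrt_mult field_simps)
      then show ?thesis by simp
    qed
    finally have le: "2 * (\<integral>\<^sup>+x. f x * g x \<partial>M) \<le> ennreal (2 * sqrt (a * b))" .
    then have "(\<integral>\<^sup>+x. f x * g x \<partial>M) \<noteq> top"
      by (auto simp: ennreal_mult_top top_unique)
    then obtain c where c: "(\<integral>\<^sup>+x. f x * g x \<partial>M) = ennreal c" "0 \<le> c"
      by (metis ennreal_cases)
    have "ennreal (2 * c) = 2 * ennreal c" using c by (simp add: ennreal_mult)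
    with le c have "c \<le> sqrt (a * b)"
      by (metis (no_types, lifting) ab(2,4) ennreal_le_iff less_imp_le mult_le_cancel_left_pos
          mult_pos_pos real_sqrt_ge_0_iff zero_less_numeral mult_nonneg_nonneg zero_le_numeral)
    then have "c\<^sup>2 \<le> a * b"
      using c ab by (metis less_imp_le mult_pos_pos power_mono real_sqrt_pow2)
    then show ?thesis
      using ab c by (simp add: ennreal_power ennreal_mult[symmetric] ennreal_leI)
  qed
qed

text \<open>The product is split so that the second Cauchy--Schwarz factor is computed exactly by
  the push-forward identity. With an indicator for \<phi> the bound yields absolute continuity of
  the push-forward; with a square-integrable \<phi> it yields convergence of the pairing and the
  norm estimate.\<close>

lemma nn_integral_pushforward_bound:
  fixes u :: "(real^2) \<times> (real^2) \<Rightarrow> real" and \<phi> :: "(real^2) \<times> real \<Rightarrow> ennreal"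
  assumes [measurable]: "u \<in> borel_measurable borel" "\<phi> \<in> borel_measurable borel"
    and u: "\<And>p. 0 \<le> u p"
  shows "(\<integral>\<^sup>+p. ennreal (u p) * \<phi> (sum_map p) \<partial>lborel)\<^sup>2
    \<le> (\<integral>\<^sup>+p. ennreal ((u p)\<^sup>2 / jac p) \<partial>lborel)
        * (ennreal pi * (\<integral>\<^sup>+q. (\<phi> q)\<^sup>2 * indicator conv_supp q \<partial>lborel))"
proof -
  have j: "0 < jac p" for p using jac_ge_2[of p] by simp
  have "(\<integral>\<^sup>+p. ennreal (u p) * \<phi> (sum_map p) \<partial>lborel)
      = (\<integral>\<^sup>+p. ennreal (u p / sqrt (jac p)) * (ennreal (sqrt (jac p)) * \<phi> (sum_map p)) \<partial>lborel)"
  proof (rule nn_integral_cong)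
    fix p
    have "ennreal (u p) = ennreal (u p / sqrt (jac p)) * ennreal (sqrt (jac p))"
      using j[of p] u[of p] by (subst ennreal_mult[symmetric]) auto
    then show "ennreal (u p) * \<phi> (sum_map p)
        = ennreal (u p / sqrt (jac p)) * (ennreal (sqrt (jac p)) * \<phi> (sum_map p))"
      by (simp add: mult.assoc)
  qed
  also have "\<dots>\<^sup>2 \<le> (\<integral>\<^sup>+p. (ennreal (u p / sqrt (jac p)))\<^sup>2 \<partial>lborel)
      * (\<integral>\<^sup>+p. (ennreal (sqrt (jac p)) * \<phi> (sum_map p))\<^sup>2 \<partial>lborel)"
    by (rule nn_integral_Cauchy_Schwarz) measurable
  also have "(\<lambda>p. (ennreal (u p / sqrt (jac p)))\<^sup>2) = (\<lambda>p. ennreal ((u p)\<^sup>2 / jac p))"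
  proof
    show "(ennreal (u p / sqrt (jac p)))\<^sup>2 = ennreal ((u p)\<^sup>2 / jac p)" for p
      using j[of p] u[of p] by (simp add: ennreal_power power_divide)
  qed
  also have "(\<lambda>p. (ennreal (sqrt (jac p)) * \<phi> (sum_map p))\<^sup>2)
      = (\<lambda>p. ennreal (jac p) * (\<phi> (sum_map p))\<^sup>2)"
  proof
    show "(ennreal (sqrt (jac p)) * \<phi> (sum_map p))\<^sup>2 = ennreal (jac p) * (\<phi> (sum_map p))\<^sup>2" for p
      using j[of p] by (simp add: power_mult_distrib ennreal_power)
  qed
  also have "(\<integral>\<^sup>+p. ennreal (jac p) * (\<phi> (sum_map p))\<^sup>2 \<partial>lborel)
      = ennreal pi * (\<integral>\<^sup>+q. (\<phi> q)\<^sup>2 * indicator conv_supp q \<partial>lborel)"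
    by (rule nn_integral_jac_sum_map) measurable
  finally show ?thesis .
qed

text \<open>Testing with indicators bounds the square of the mass of B by a constant times its
  Lebesgue measure. So the push-forward is absolutely continuous and finite on balls, and
  Radon--Nikodym applies.\<close>

lemma pushforward_density_exists:
  fixes u :: "(real^2) \<times> (real^2) \<Rightarrow> real"
  assumes [measurable]: "u \<in> borel_measurable borel" and u: "\<And>p. 0 \<le> u p"
    and fin: "(\<integral>\<^sup>+p. ennreal ((u p)\<^sup>2 / jac p) \<partial>lborel) < top"
  obtains F :: "(real^2) \<times> real \<Rightarrow> real"
  where "F \<in> borel_measurable borel" "\<And>q. 0 \<le> F q"
    "distr (density lborel (\<lambda>p. ennreal (u p))) borel sum_map = density lborel (\<lambda>q. ennreal (F q))"
proof -
  define N where "N = distr (density lborel (\<lambda>p. ennreal (u p))) borel sum_map"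
  have sets_N [simp, measurable_cong]: "sets N = sets borel" by (simp add: N_def)
  have em: "emeasure N B = (\<integral>\<^sup>+p. ennreal (u p) * indicator B (sum_map p) \<partial>lborel)"
    if [measurable]: "B \<in> sets borel" for B
  proof -
    have [measurable]: "sum_map -` B \<in> sets borel"
      using measurable_sets[OF measurable_sum_map that] by simp
    show ?thesis
      unfolding N_def
      by (subst emeasure_distr, simp, simp, subst emeasure_density)
        (auto intro!: nn_integral_cong split: split_indicator)
  qed
  have bound: "(emeasure N B)\<^sup>2 \<le> (\<integral>\<^sup>+p. ennreal ((u p)\<^sup>2 / jac p) \<partial>lborel) * (ennreal pi * emeasure lborel B)"
    if [measurable]: "B \<in> sets borel" for B
  proof -
    have "(emeasure N B)\<^sup>2 \<le> (\<integral>\<^sup>+p. ennreal ((u p)\<^sup>2 / jac p) \<partial>lborel)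
        * (ennreal pi * (\<integral>\<^sup>+q. (indicator B q)\<^sup>2 * indicator conv_supp q \<partial>lborel))"
      unfolding em[OF that] by (rule nn_integral_pushforward_bound) (use u in auto)
    also have "(\<integral>\<^sup>+q. (indicator B q)\<^sup>2 * indicator conv_supp q \<partial>lborel)
        \<le> (\<integral>\<^sup>+q. indicator B q \<partial>lborel)"
      by (intro nn_integral_mono) (auto split: split_indicator)
    also have "\<dots> = emeasure lborel B" by simp
    finally show ?thesis by (simp add: mult_left_mono)
  qed
  have ac: "absolutely_continuous lborel N"
    unfolding absolutely_continuous_def
  proof
    fix B :: "((real^2) \<times> real) set" assume "B \<in> null_sets lborel"
    with bound[of B] show "B \<in> null_sets N" by (auto simp: null_sets_def)
  qed
  have sf: "sigma_finite_measure N"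
  proof
    show "\<exists>A. countable A \<and> A \<subseteq> sets N \<and> \<Union> A = space N \<and> (\<forall>a\<in>A. emeasure N a \<noteq> \<infinity>)"
    proof (intro exI[of _ "range (\<lambda>n::nat. cball 0 (real n))"] conjI ballI)
      show "\<Union> (range (\<lambda>n::nat. cball 0 (real n))) = space N"
        using sets_eq_imp_space_eq[OF sets_N] by (auto simp: real_arch_simple)
      fix a :: "((real^2) \<times> real) set" assume "a \<in> range (\<lambda>n::nat. cball 0 (real n))"
      then obtain n where a: "a = cball 0 (real n)" by auto
      have "(emeasure N a)\<^sup>2 \<le> (\<integral>\<^sup>+p. ennreal ((u p)\<^sup>2 / jac p) \<partial>lborel) * (ennreal pi * emeasure lborel a)"
        by (rule bound) (simp add: a)
      also have "\<dots> < top"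
        using fin emeasure_lborel_cball_finite[of "0 :: (real^2) \<times> real" "real n"]
        by (simp add: a ennreal_mult_less_top)
      finally show "emeasure N a \<noteq> \<infinity>" by auto
    qed auto
  qed
  have dens: "density lborel (RN_deriv lborel N) = N"
    by (rule sigma_finite_measure.density_RN_deriv[OF sigma_finite_lborel]) (use ac in auto)
  \<comment> \<open>Sigma-finiteness of \<open>N\<close> makes its derivative finite almost
    everywhere, so replacing it by a real-valued function does not change the measure.\<close>
  have AE_fin: "AE q in lborel. RN_deriv lborel N q \<noteq> \<infinity>"
    by (rule sigma_finite_measure.RN_deriv_finite[OF sigma_finite_lborel]) (use ac sf in auto)
  show thesis
  proof
    show "(\<lambda>q. enn2real (RN_deriv lborel N q)) \<in> borel_measurable borel" by measurable
    show "distr (density lborel (\<lambda>p. ennreal (u p))) borel sum_map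
        = density lborel (\<lambda>q. ennreal (enn2real (RN_deriv lborel N q)))"
    proof -
      have "density lborel (\<lambda>q. ennreal (enn2real (RN_deriv lborel N q))) = density lborel (RN_deriv lborel N)"
        by (rule density_cong) (use AE_fin in \<open>auto simp: less_top\<close>)
      then show ?thesis using dens by (simp add: N_def)
    qed
  qed simp
qed

text \<open>
  \<open>pushes_to H F\<close>: the push-forward of \<open>H dy dy'\<close> under \<open>sum_map\<close> has the Lebesgue density \<open>F\<close>. Testing
  against \<open>L2_fun\<close> instead of bounded sets makes the \<open>L\<^sup>2\<close> bound below a direct duality argument.
\<close>

definition pushes_to ::
    "((real^2) \<times> (real^2) \<Rightarrow> complex) \<Rightarrow> ((real^2) \<times> real \<Rightarrow> complex) \<Rightarrow> bool" where
  "pushes_to H F \<longleftrightarrow> F \<in> borel_measurable borel \<and>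
     (\<forall>\<phi>\<in>L2_fun. integrable lborel (\<lambda>q. F q * \<phi> q) \<and> integrable lborel (\<lambda>p. H p * \<phi> (sum_map p)) \<and>
        (LINT q|lborel. F q * \<phi> q) = (LINT p|lborel. H p * \<phi> (sum_map p)))"

section \<open>Push-forwards of complex densities by duality\<close>

lemma L2_fun_measurable: "f \<in> L2_fun \<Longrightarrow> f \<in> borel_measurable borel"
  by (simp add: L2_fun_def)

lemma nn_integral_L2_fun:
  assumes "f \<in> L2_fun"
  shows "(\<integral>\<^sup>+x. ennreal ((cmod (f x))\<^sup>2) \<partial>lborel) = ennreal ((L2_norm f)\<^sup>2)"
  using assms by (simp add: L2_fun_def L2_norm_def nn_integral_eq_integral)

lemma L2_funI:
  assumes [measurable]: "f \<in> borel_measurable borel"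
    and le: "(\<integral>\<^sup>+x. ennreal ((cmod (f x))\<^sup>2) \<partial>lborel) \<le> ennreal c" and c: "0 \<le> c"
  shows "f \<in> L2_fun" "(L2_norm f)\<^sup>2 \<le> c"
proof -
  show *: "f \<in> L2_fun"
    using le le_less_trans[OF le] by (auto simp: L2_fun_def integrable_iff_bounded)
  show "(L2_norm f)\<^sup>2 \<le> c"
    using le c unfolding nn_integral_L2_fun[OF *] by simp
qed

lemma pushes_to_lincomb:
  assumes "pushes_to H F" "pushes_to H' F'"
  shows "pushes_to (\<lambda>p. a * H p + b * H' p) (\<lambda>q. a * F q + b * F' q)"
  unfolding pushes_to_def
proof (intro conjI ballI)
  show "(\<lambda>q. a * F q + b * F' q) \<in> borel_measurable borel"
    using assms by (auto simp: pushes_to_def)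
  fix \<phi> :: "(real^2) \<times> real \<Rightarrow> complex" assume "\<phi> \<in> L2_fun"
  with assms have
    i: "integrable lborel (\<lambda>q. F q * \<phi> q)" "integrable lborel (\<lambda>q. F' q * \<phi> q)"
      "integrable lborel (\<lambda>p. H p * \<phi> (sum_map p))" "integrable lborel (\<lambda>p. H' p * \<phi> (sum_map p))"
    and e: "(LINT q|lborel. F q * \<phi> q) = (LINT p|lborel. H p * \<phi> (sum_map p))"
      "(LINT q|lborel. F' q * \<phi> q) = (LINT p|lborel. H' p * \<phi> (sum_map p))"
    by (auto simp: pushes_to_def)
  have 1: "(\<lambda>q. (a * F q + b * F' q) * \<phi> q) = (\<lambda>q. a * (F q * \<phi> q) + b * (F' q * \<phi> q))"
    and 2: "(\<lambda>p. (a * H p + b * H' p) * \<phi> (sum_map p))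
      = (\<lambda>p. a * (H p * \<phi> (sum_map p)) + b * (H' p * \<phi> (sum_map p)))"
    by (simp_all add: algebra_simps)
  show "integrable lborel (\<lambda>q. (a * F q + b * F' q) * \<phi> q)"
    "integrable lborel (\<lambda>p. (a * H p + b * H' p) * \<phi> (sum_map p))"
    unfolding 1 2 by (intro Bochner_Integration.integrable_add integrable_mult_right i)+
  show "(LINT q|lborel. (a * F q + b * F' q) * \<phi> q) = (LINT p|lborel. (a * H p + b * H' p) * \<phi> (sum_map p))"
    unfolding 1 2 using i e by simp
qed

text \<open>H itself may fail to be integrable; Cauchy--Schwarz on the moduli still makes the
  pairing absolutely convergent.\<close>

lemma integrable_pushforward:
  assumes [measurable]: "H \<in> borel_measurable borel"
    and fin: "(\<integral>\<^sup>+p. ennreal ((cmod (H p))\<^sup>2 / jac p) \<partial>lborel) < top"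
    and \<phi>: "\<phi> \<in> L2_fun"
  shows "integrable lborel (\<lambda>p. H p * \<phi> (sum_map p))"
proof (rule integrableI_bounded)
  note [measurable] = L2_fun_measurable[OF \<phi>]
  show "(\<lambda>p. H p * \<phi> (sum_map p)) \<in> borel_measurable lborel" by measurable
  have "(\<integral>\<^sup>+p. ennreal (norm (H p * \<phi> (sum_map p))) \<partial>lborel)\<^sup>2
      = (\<integral>\<^sup>+p. ennreal (cmod (H p)) * ennreal (cmod (\<phi> (sum_map p))) \<partial>lborel)\<^sup>2"
    by (simp add: norm_mult ennreal_mult)
  also have "\<dots> \<le> (\<integral>\<^sup>+p. ennreal ((cmod (H p))\<^sup>2 / jac p) \<partial>lborel)
        * (ennreal pi * (\<integral>\<^sup>+q. (ennreal (cmod (\<phi> q)))\<^sup>2 * indicator conv_supp q \<partial>lborel))"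
    by (rule nn_integral_pushforward_bound) measurable
  also have "\<dots> < top"
  proof -
    have "(\<integral>\<^sup>+q. (ennreal (cmod (\<phi> q)))\<^sup>2 * indicator conv_supp q \<partial>lborel)
        \<le> (\<integral>\<^sup>+q. ennreal ((cmod (\<phi> q))\<^sup>2) \<partial>lborel)"
      by (intro nn_integral_mono) (auto simp: ennreal_power split: split_indicator)
    also have "\<dots> < top" unfolding nn_integral_L2_fun[OF \<phi>] by simp
    finally show ?thesis using fin by (simp add: ennreal_mult_less_top)
  qed
  finally show "(\<integral>\<^sup>+p. ennreal (norm (H p * \<phi> (sum_map p))) \<partial>lborel) < \<infinity>"
    by (simp add: power_less_top_ennreal)
qed

lemma pushes_to_nonneg:
  assumes [measurable]: "u \<in> borel_measurable borel" "F \<in> borel_measurable borel"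
    and nn: "\<And>p. 0 \<le> u p" "\<And>q. 0 \<le> F q"
    and fin: "(\<integral>\<^sup>+p. ennreal ((u p)\<^sup>2 / jac p) \<partial>lborel) < top"
    and eq: "distr (density lborel (\<lambda>p. ennreal (u p))) borel sum_map = density lborel (\<lambda>q. ennreal (F q))"
  shows "pushes_to (\<lambda>p. complex_of_real (u p)) (\<lambda>q. complex_of_real (F q))"
  unfolding pushes_to_def
proof (intro conjI ballI)
  fix \<phi> :: "(real^2) \<times> real \<Rightarrow> complex" assume \<phi>: "\<phi> \<in> L2_fun"
  note [measurable] = L2_fun_measurable[OF \<phi>]
  show i: "integrable lborel (\<lambda>p. complex_of_real (u p) * \<phi> (sum_map p))"
    by (rule integrable_pushforward[OF _ _ \<phi>]) (use fin nn in auto)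
  have "integrable (density lborel (\<lambda>p. ennreal (u p))) (\<lambda>p. \<phi> (sum_map p))"
    using i nn by (subst integrable_density) (auto simp: scaleR_conv_of_real)
  then have "integrable (density lborel (\<lambda>q. ennreal (F q))) \<phi>"
    unfolding eq[symmetric] by (subst integrable_distr_eq) auto
  then show "integrable lborel (\<lambda>q. complex_of_real (F q) * \<phi> q)"
    using nn by (subst (asm) integrable_density) (auto simp: scaleR_conv_of_real)
  have "(LINT q|lborel. complex_of_real (F q) * \<phi> q) = integral\<^sup>L (density lborel (\<lambda>q. ennreal (F q))) \<phi>"
    using nn by (subst integral_density) (auto simp: scaleR_conv_of_real)
  also have "\<dots> = integral\<^sup>L (density lborel (\<lambda>p. ennreal (u p))) (\<lambda>p. \<phi> (sum_map p))"
    unfolding eq[symmetric] by (subst integral_distr) auto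
  also have "\<dots> = (LINT p|lborel. complex_of_real (u p) * \<phi> (sum_map p))"
    using nn by (subst integral_density) (auto simp: scaleR_conv_of_real)
  finally show "(LINT q|lborel. complex_of_real (F q) * \<phi> q)
      = (LINT p|lborel. complex_of_real (u p) * \<phi> (sum_map p))" .
qed measurable

text \<open>The positive and negative parts of Re H and Im H are bounded by |H|, so each has finite
  weighted norm and a nonnegative density; linearity recombines the four.\<close>

lemma pushes_to_exists:
  assumes [measurable]: "H \<in> borel_measurable borel"
    and fin: "(\<integral>\<^sup>+p. ennreal ((cmod (H p))\<^sup>2 / jac p) \<partial>lborel) < top"
  obtains F where "pushes_to H F"
proof -
  have j: "0 < jac p" for p using jac_ge_2[of p] by simp
  have part: "\<exists>F. pushes_to (\<lambda>p. complex_of_real (max 0 (g (H p)))) F"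
    if [measurable]: "g \<in> borel_measurable borel" and le: "\<And>z. g z \<le> cmod z" for g :: "complex \<Rightarrow> real"
  proof -
    let ?u = "\<lambda>p. max 0 (g (H p))"
    have "(\<integral>\<^sup>+p. ennreal ((?u p)\<^sup>2 / jac p) \<partial>lborel) \<le> (\<integral>\<^sup>+p. ennreal ((cmod (H p))\<^sup>2 / jac p) \<partial>lborel)"
      using le j by (intro nn_integral_mono ennreal_leI divide_right_mono power_mono) (auto simp: less_imp_le)
    with fin have *: "(\<integral>\<^sup>+p. ennreal ((?u p)\<^sup>2 / jac p) \<partial>lborel) < top" by simp
    obtain F where "F \<in> borel_measurable borel" "\<And>q. 0 \<le> F q"
      "distr (density lborel (\<lambda>p. ennreal (?u p))) borel sum_map = density lborel (\<lambda>q. ennreal (F q))"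
      by (rule pushforward_density_exists[OF _ _ *]) auto
    then show ?thesis using pushes_to_nonneg[of ?u F] * by auto
  qed
  obtain F1 where F1: "pushes_to (\<lambda>p. complex_of_real (max 0 (Re (H p)))) F1"
    using part[of Re] complex_Re_le_cmod by auto
  obtain F2 where F2: "pushes_to (\<lambda>p. complex_of_real (max 0 (- Re (H p)))) F2"
    using part[of "\<lambda>z. - Re z"] abs_Re_le_cmod by (auto simp: abs_le_iff)
  obtain F3 where F3: "pushes_to (\<lambda>p. complex_of_real (max 0 (Im (H p)))) F3"
    using part[of Im] abs_Im_le_cmod by (auto simp: abs_le_iff)
  obtain F4 where F4: "pushes_to (\<lambda>p. complex_of_real (max 0 (- Im (H p)))) F4"
    using part[of "\<lambda>z. - Im z"] abs_Im_le_cmod by (auto simp: abs_le_iff)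
  note P = pushes_to_lincomb[OF pushes_to_lincomb[OF F1 F2, of 1 "-1"]
      pushes_to_lincomb[OF F3 F4, of 1 "-1"], of 1 \<i>]
  have eqH: "(\<lambda>p. 1 * (1 * complex_of_real (max 0 (Re (H p))) + - 1 * complex_of_real (max 0 (- Re (H p)))) +
        \<i> * (1 * complex_of_real (max 0 (Im (H p))) + - 1 * complex_of_real (max 0 (- Im (H p))))) = H"
    by (rule ext) (auto simp: complex_eq_iff max_def)
  show thesis by (rule that[OF P[unfolded eqH]])
qed

text \<open>Pairing F with its own truncated conjugate gives X^2 \<le> pi A X, where X is the
  truncated squared norm and A the weighted norm of H. Cancelling X and removing the truncation by
  monotone convergence gives the bound.\<close>

lemma pushes_to_L2_bound:
  assumes [measurable]: "H \<in> borel_measurable borel" and push: "pushes_to H F"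
  shows "(\<integral>\<^sup>+q. ennreal ((cmod (F q))\<^sup>2) \<partial>lborel)
    \<le> ennreal pi * (\<integral>\<^sup>+p. ennreal ((cmod (H p))\<^sup>2 / jac p) \<partial>lborel)"
proof -
  let ?A = "\<integral>\<^sup>+p. ennreal ((cmod (H p))\<^sup>2 / jac p) \<partial>lborel"
  have [measurable]: "F \<in> borel_measurable borel" using push by (simp add: pushes_to_def)
  have [measurable]: "cnj \<in> borel_measurable borel"
    by (intro borel_measurable_continuous_onI continuous_intros)
  \<comment> \<open>F is not yet known to be square integrable, so both its domain and its values
    are truncated; the restricted conjugate is then an admissible test function.\<close>
  define B where "B n = {q \<in> space borel. norm q \<le> real n \<and> cmod (F q) \<le> real n}" for n
  have [measurable]: "B n \<in> sets borel" for n unfolding B_def by measurable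
  have bound: "(\<integral>\<^sup>+q. ennreal ((cmod (F q))\<^sup>2) * indicator (B n) q \<partial>lborel) \<le> ennreal pi * ?A" for n
  proof -
    let ?X = "\<integral>\<^sup>+q. ennreal ((cmod (F q))\<^sup>2) * indicator (B n) q \<partial>lborel"
    define \<phi> where "\<phi> q = cnj (F q) * indicator (B n) q" for q
    have [measurable]: "\<phi> \<in> borel_measurable borel" unfolding \<phi>_def by measurable
    have sq: "ennreal ((cmod (\<phi> q))\<^sup>2) = ennreal ((cmod (F q))\<^sup>2) * indicator (B n) q" for q
      by (auto simp: \<phi>_def norm_mult split: split_indicator)
    have "?X \<le> (\<integral>\<^sup>+q. ennreal ((real n)\<^sup>2) * indicator (cball (0 :: (real^2) \<times> real) (real n)) q \<partial>lborel)"
      by (intro nn_integral_mono) (auto simp: B_def power_mono ennreal_leI split: split_indicator)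
    also have "\<dots> < top"
      using emeasure_lborel_cball_finite[of "0 :: (real^2) \<times> real" "real n"]
      by (subst nn_integral_cmult_indicator) (auto simp: ennreal_mult_less_top)
    finally have fin: "?X < top" .
    then obtain x where x: "?X = ennreal x" "0 \<le> x" by (cases ?X rule: ennreal_cases) auto
    have \<phi>L: "\<phi> \<in> L2_fun"
      by (rule L2_funI(1)[of _ x]) (use x sq in auto)
    have eq: "(\<lambda>q. F q * \<phi> q) = (\<lambda>q. complex_of_real ((cmod (F q))\<^sup>2 * indicator (B n) q))"
    proof
      show "F q * \<phi> q = complex_of_real ((cmod (F q))\<^sup>2 * indicator (B n) q)" for q
        by (cases "q \<in> B n") (simp_all add: \<phi>_def complex_norm_square[symmetric])
    qed
    have "(LINT q|lborel. F q * \<phi> q) = complex_of_real x"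
    proof -
      have "(LINT q|lborel. (cmod (F q))\<^sup>2 * indicator (B n) q) = x"
        using x by (intro integral_eq_nn_integral[THEN trans])
          (auto simp: ennreal_mult ennreal_indicator)
      then show ?thesis unfolding eq integral_complex_of_real by (simp only:)
    qed
    then have "complex_of_real x = (LINT p|lborel. H p * \<phi> (sum_map p))"
      using push \<phi>L by (simp add: pushes_to_def)
    from this[symmetric] have "x = cmod (LINT p|lborel. H p * \<phi> (sum_map p))"
      using x by simp
    then have "ennreal x \<le> (\<integral>\<^sup>+p. ennreal (norm (H p * \<phi> (sum_map p))) \<partial>lborel)"
      using integral_norm_bound_ennreal[of lborel "\<lambda>p. H p * \<phi> (sum_map p)"] push \<phi>L
      by (simp add: pushes_to_def)
    also have "\<dots> = (\<integral>\<^sup>+p. ennreal (cmod (H p)) * ennreal (cmod (\<phi> (sum_map p))) \<partial>lborel)"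
      by (simp add: norm_mult ennreal_mult)
    finally have "(ennreal x)\<^sup>2 \<le> (\<integral>\<^sup>+p. ennreal (cmod (H p)) * ennreal (cmod (\<phi> (sum_map p))) \<partial>lborel)\<^sup>2"
      by (rule power_mono) simp
    also have "\<dots> \<le> ?A * (ennreal pi * (\<integral>\<^sup>+q. (ennreal (cmod (\<phi> q)))\<^sup>2 * indicator conv_supp q \<partial>lborel))"
      by (rule nn_integral_pushforward_bound) measurable
    also have "\<dots> \<le> ?A * (ennreal pi * ?X)"
      by (intro mult_left_mono nn_integral_mono)
        (auto simp: sq[symmetric] ennreal_power split: split_indicator)
    finally have le: "ennreal x * ennreal x \<le> (ennreal pi * ?A) * ennreal x"
      unfolding x(1) power2_eq_square[of "ennreal x"] by (simp only: ac_simps)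
    \<comment> \<open>A finite nonzero x can be cancelled; the cases x = 0 and an infinite
      right-hand side are immediate.\<close>
    show ?thesis
    proof (cases "x = 0 \<or> ?A = top")
      case True
      then show ?thesis using x by (auto simp: ennreal_mult_top)
    next
      case False
      then obtain a where a: "?A = ennreal a" "0 \<le> a" by (cases ?A rule: ennreal_cases) auto
      with le x have "x * x \<le> (pi * a) * x"
        by (simp add: ennreal_mult[symmetric] ennreal_le_iff)
      with False x have "x \<le> pi * a" by simp
      then show ?thesis using a x by (simp add: ennreal_mult[symmetric] ennreal_leI)
    qed
  qed
  have "(\<integral>\<^sup>+q. ennreal ((cmod (F q))\<^sup>2) \<partial>lborel)
      = (\<integral>\<^sup>+q. (SUP n. ennreal ((cmod (F q))\<^sup>2) * indicator (B n) q) \<partial>lborel)"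
  proof (rule nn_integral_cong)
    fix q
    obtain n where n: "max (norm q) (cmod (F q)) \<le> real n" using real_arch_simple by blast
    show "ennreal ((cmod (F q))\<^sup>2) = (SUP n. ennreal ((cmod (F q))\<^sup>2) * indicator (B n) q)"
    proof (rule antisym)
      have "ennreal ((cmod (F q))\<^sup>2) = ennreal ((cmod (F q))\<^sup>2) * indicator (B n) q"
        using n by (simp add: B_def)
      also have "\<dots> \<le> (SUP n. ennreal ((cmod (F q))\<^sup>2) * indicator (B n) q)"
        by (rule SUP_upper) simp
      finally show "ennreal ((cmod (F q))\<^sup>2) \<le> \<dots>" .
    qed (auto intro!: SUP_least split: split_indicator)
  qed
  also have "\<dots> = (SUP n. \<integral>\<^sup>+q. ennreal ((cmod (F q))\<^sup>2) * indicator (B n) q \<partial>lborel)"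
    by (rule nn_integral_monotone_convergence_SUP)
      (auto simp: incseq_def le_fun_def B_def split: split_indicator)
  also have "\<dots> \<le> ennreal pi * ?A"
    by (rule SUP_least) (rule bound)
  finally show ?thesis .
qed

section \<open>Densities of convolutions\<close>

definition lift :: "real^2 \<Rightarrow> (real^2) \<times> real" where
  "lift y = (y, phase y)"

lemma measurable_lift [measurable]: "lift \<in> borel_measurable borel"
  unfolding lift_def by (intro borel_measurable_Pair) auto

lemma \<sigma>_eq: "\<sigma> = distr lborel borel lift"
  unfolding \<sigma>_def lift_def phase_def ..

text \<open>Allows the product of two copies of \<sigma> to be written as one push-forward. Balls
  have finite mass because \<open>lift\<close> does not decrease norms.\<close>

lemma sigma_finite_\<sigma>: "sigma_finite_measure \<sigma>"
proof
  show "\<exists>A. countable A \<and> A \<subseteq> sets \<sigma> \<and> \<Union> A = space \<sigma> \<and> (\<forall>a\<in>A. emeasure \<sigma> a \<noteq> \<infinity>)"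
  proof (intro exI[of _ "range (\<lambda>n::nat. cball 0 (real n))"] conjI ballI)
    show "\<Union> (range (\<lambda>n::nat. cball 0 (real n))) = space \<sigma>"
      by (auto simp: \<sigma>_eq real_arch_simple)
    fix a :: "((real^2) \<times> real) set" assume "a \<in> range (\<lambda>n::nat. cball 0 (real n))"
    then obtain n where a: "a = cball 0 (real n)" by auto
    have "lift -` a \<inter> space lborel \<subseteq> cball 0 (real n)"
      using norm_fst_le order_trans by (fastforce simp: a lift_def)
    then have "emeasure \<sigma> a \<le> emeasure lborel (cball 0 (real n) :: (real^2) set)"
      unfolding \<sigma>_eq by (subst emeasure_distr) (auto simp: a intro!: emeasure_mono)
    also have "\<dots> < \<infinity>" by (rule emeasure_lborel_cball_finite)
    finally show "emeasure \<sigma> a \<noteq> \<infinity>" by simp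
  qed (auto simp: \<sigma>_eq)
qed

lemma lift_add: "lift y + lift y' = sum_map (y, y')"
  by (simp add: lift_def sum_map_def)

text \<open>Pulls the double integral over the surface back to the parameter plane in each factor,
  where addition of surface points becomes \<open>sum_map\<close>.\<close>

lemma conv_density_iff:
  assumes [measurable]: "h \<in> borel_measurable borel" "k \<in> borel_measurable borel"
  shows "conv_density h k F \<longleftrightarrow> F \<in> borel_measurable borel \<and>
     (\<forall>B \<in> sets borel. bounded B \<longrightarrow> set_integrable lborel B F \<and>
        has_bochner_integral lborel (\<lambda>p. h (fst p) * k (snd p) * indicator B (sum_map p))
          (LINT x:B|lborel. F x))"
proof -
  have "\<sigma> \<Otimes>\<^sub>M \<sigma> = distr (lborel \<Otimes>\<^sub>M lborel) (borel \<Otimes>\<^sub>M borel) (\<lambda>(y, y'). (lift y, lift y'))"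
    using sigma_finite_\<sigma> unfolding \<sigma>_eq by (intro pair_measure_distr) auto
  then have eq: "\<sigma> \<Otimes>\<^sub>M \<sigma> = distr lborel borel (\<lambda>p. (lift (fst p), lift (snd p)))"
    by (simp add: lborel_prod borel_prod case_prod_beta')
  have "has_bochner_integral (\<sigma> \<Otimes>\<^sub>M \<sigma>)
          (\<lambda>(p, q). indicator B (p + q) * (h (fst p) * k (fst q))) c \<longleftrightarrow>
        has_bochner_integral lborel (\<lambda>p. h (fst p) * k (snd p) * indicator B (sum_map p)) c"
    if [measurable]: "B \<in> sets borel" for B c
  proof -
    have [measurable]: "(\<lambda>p. (lift (fst p), lift (snd p))) \<in> borel_measurable borel"
      by (intro borel_measurable_Pair) measurable
    have [measurable]: "(\<lambda>p::((real^2) \<times> real) \<times> ((real^2) \<times> real). indicator B (fst p + snd p) * (h (fst (fst p)) * k (fst (snd p))))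
        \<in> borel_measurable borel"
      by measurable
    show ?thesis
      unfolding eq case_prod_beta'
      by (simp add: has_bochner_integral_iff integrable_distr_eq integral_distr lift_add)
        (simp add: lift_def ac_simps)
  qed
  then show ?thesis by (simp add: conv_density_def cong: conj_cong)
qed

lemma indicator_L2_fun:
  assumes "B \<in> sets borel" "bounded B"
  shows "(indicator B :: 'a::euclidean_space \<Rightarrow> complex) \<in> L2_fun"
proof -
  have "emeasure lborel B < \<infinity>" by (rule emeasure_bounded_finite) fact
  moreover have "(\<lambda>x. (cmod (indicator B x))\<^sup>2) = (indicator B :: 'a \<Rightarrow> real)"
    by (auto split: split_indicator)
  ultimately show ?thesis
    using assms by (simp add: L2_fun_def)
qed

lemma pushes_to_imp_conv_density:
  assumes [measurable]: "h \<in> borel_measurable borel" "k \<in> borel_measurable borel"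
    and push: "pushes_to (\<lambda>p. h (fst p) * k (snd p)) F"
  shows "conv_density h k F"
  unfolding conv_density_iff[OF assms(1,2)]
proof (intro conjI ballI impI)
  show "F \<in> borel_measurable borel" using push by (simp add: pushes_to_def)
  fix B :: "((real^2) \<times> real) set" assume B: "B \<in> sets borel" "bounded B"
  have ind: "indicator B q *\<^sub>R F q = F q * indicator B q" for q
    by (auto split: split_indicator)
  note P = push[unfolded pushes_to_def, THEN conjunct2, rule_format, OF indicator_L2_fun[OF B]]
  show "set_integrable lborel B F"
    using P unfolding set_integrable_def ind by blast
  show "has_bochner_integral lborel (\<lambda>p. h (fst p) * k (snd p) * indicator B (sum_map p)) (LINT x:B|lborel. F x)"
    using P unfolding has_bochner_integral_iff set_lebesgue_integral_def ind by simp
qed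

text \<open>The densities are only locally integrable, so uniqueness is applied to their
  restrictions to balls of integer radius, and the countably many exceptional null sets are
  collected.\<close>

lemma conv_density_unique:
  assumes meas: "h \<in> borel_measurable borel" "k \<in> borel_measurable borel"
    and F: "conv_density h k F" and F': "conv_density h k F'"
  shows "AE q in lborel. F q = F' q"
proof -
  note F = F[unfolded conv_density_iff[OF meas]] and F' = F'[unfolded conv_density_iff[OF meas]]
  have *: "AE q in lborel. indicator (cball 0 (real n)) q *\<^sub>R F q = indicator (cball 0 (real n)) q *\<^sub>R F' q" for n :: nat
  proof (rule sigma_finite_measure.density_unique_banach[OF sigma_finite_lborel])
    show "integrable lborel (\<lambda>q. indicator (cball 0 (real n)) q *\<^sub>R F q)"
      "integrable lborel (\<lambda>q. indicator (cball 0 (real n)) q *\<^sub>R F' q)"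
      using F F' by (auto simp: set_integrable_def)
    fix A :: "((real^2) \<times> real) set" assume "A \<in> sets lborel"
    then have "A \<inter> cball 0 (real n) \<in> sets borel" "bounded (A \<inter> cball 0 (real n))"
      by (auto intro: bounded_subset[OF bounded_cball])
    then have "(LINT x:A \<inter> cball 0 (real n)|lborel. F x) = (LINT x:A \<inter> cball 0 (real n)|lborel. F' x)"
      using F F' by (blast intro: has_bochner_integral_eq)
    then show "(LINT q:A|lborel. indicator (cball 0 (real n)) q *\<^sub>R F q)
        = (LINT q:A|lborel. indicator (cball 0 (real n)) q *\<^sub>R F' q)"
      by (simp add: set_lebesgue_integral_def indicator_inter_arith)
  qed
  then have "AE q in lborel. \<forall>n::nat. indicator (cball 0 (real n)) q *\<^sub>R F q = indicator (cball 0 (real n)) q *\<^sub>R F' q"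
    by (subst AE_all_countable) blast
  then show ?thesis
  proof eventually_elim
    case (elim q)
    obtain n where "norm q \<le> real n" using real_arch_simple by blast
    with elim[rule_format, of n] show ?case by simp
  qed
qed

section \<open>The gain away from the origin\<close>

definition wtensor :: "(real^2 \<Rightarrow> complex) \<Rightarrow> (real^2) \<times> (real^2) \<Rightarrow> complex" where
  "wtensor f p = f (fst p) * complex_of_real (sqrt (w (fst p))) * (f (snd p) * complex_of_real (sqrt (w (snd p))))"

lemma measurable_w [measurable]: "w \<in> borel_measurable borel"
  unfolding w_def by measurable

lemma w_eq_sqrt: "w y = sqrt (1 + (norm y)\<^sup>2)"
  by (simp add: w_def powr_half_sqrt)

lemma w_pos: "0 < w y"
  by (simp add: w_eq_sqrt add_pos_nonneg)

text \<open>The fraction is s / (2 (1 + s)) at s = \<rho>^2: the relative gain over the factor 1/2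
  when one of the two points has norm at least \<rho>.\<close>

lemma gap_bounds:
  fixes \<rho> :: real
  shows "0 \<le> \<rho>\<^sup>2 / (2 * (1 + \<rho>\<^sup>2))" "\<rho>\<^sup>2 / (2 * (1 + \<rho>\<^sup>2)) \<le> 1"
proof -
  have "\<rho>\<^sup>2 \<le> 2 * (1 + \<rho>\<^sup>2)" "0 < 2 * (1 + \<rho>\<^sup>2)" by (auto simp: add_pos_nonneg)
  then show "\<rho>\<^sup>2 / (2 * (1 + \<rho>\<^sup>2)) \<le> 1" by (simp only: divide_le_eq_1_pos)
qed simp

text \<open>Only the size of y is exploited for the gain, not that of y'. The bound is then a
  product of a function of y and a function of y', and its double integral factorises.\<close>

lemma wtensor_sq_div_jac_le:
  assumes "0 < \<rho>"
  shows "(cmod (wtensor f (y, y')))\<^sup>2 / jac (y, y')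
    \<le> 1 / 2 * ((cmod (f y))\<^sup>2 * (1 - \<rho>\<^sup>2 / (2 * (1 + \<rho>\<^sup>2)) * indicator {y. \<rho> \<le> norm y} y)) * (cmod (f y'))\<^sup>2"
proof -
  define s where "s = (norm y)\<^sup>2 + (norm y')\<^sup>2"
  define \<delta> where "\<delta> = \<rho>\<^sup>2 / (2 * (1 + \<rho>\<^sup>2)) * indicator {y. \<rho> \<le> norm y} y"
  have s: "0 \<le> s" by (simp add: s_def)
  \<comment> \<open>The arithmetic-geometric mean inequality for 1 + |y|^2 and 1 + |y'|^2.\<close>
  have "w y * w y' = sqrt ((1 + (norm y)\<^sup>2) * (1 + (norm y')\<^sup>2))"
    by (simp add: w_eq_sqrt real_sqrt_mult)
  also have "\<dots> \<le> 1 + s / 2"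
    using arith_geo_mean_sqrt[of "1 + (norm y)\<^sup>2" "1 + (norm y')\<^sup>2"] by (simp add: s_def field_simps)
  finally have ww: "w y * w y' \<le> 1 + s / 2" .
  have j: "2 + 2 * s \<le> jac (y, y')" using jac_ge[of "(y, y')"] by (simp add: s_def)
  have "\<delta> \<le> s / (2 * (1 + s))"
  proof (cases "\<rho> \<le> norm y")
    case True
    then have "\<rho>\<^sup>2 \<le> s" using assms unfolding s_def
      by (meson add_increasing2 less_imp_le power_mono zero_le_power2)
    then have "\<rho>\<^sup>2 / (2 * (1 + \<rho>\<^sup>2)) \<le> s / (2 * (1 + s))"
      using s by (simp add: divide_simps add_pos_nonneg) (simp add: algebra_simps add_nonneg_eq_0_iff)
    then show ?thesis using True by (simp add: \<delta>_def)
  next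
    case False
    then show ?thesis using s by (simp add: \<delta>_def)
  qed
  moreover have "w y * w y' / jac (y, y') \<le> (1 + s / 2) / (2 + 2 * s)"
    using ww j s w_pos[of y] w_pos[of y'] by (intro frac_le) auto
  moreover have "(1 + s / 2) / (2 + 2 * s) = 1 / 2 * (1 - s / (2 * (1 + s)))"
    using s by (simp add: divide_simps add_nonneg_eq_0_iff)
  ultimately have *: "w y * w y' / jac (y, y') \<le> 1 / 2 * (1 - \<delta>)" by simp
  have "(cmod (wtensor f (y, y')))\<^sup>2 / jac (y, y')
      = ((cmod (f y))\<^sup>2 * (cmod (f y'))\<^sup>2) * (w y * w y' / jac (y, y'))"
    using w_pos[of y] w_pos[of y']
    by (simp add: wtensor_def norm_mult power_mult_distrib ac_simps less_imp_le)
  also have "\<dots> \<le> ((cmod (f y))\<^sup>2 * (cmod (f y'))\<^sup>2) * (1 / 2 * (1 - \<delta>))"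
    by (intro mult_left_mono *) simp
  finally show ?thesis by (simp add: \<delta>_def ac_simps)
qed

lemma measurable_wtensor [measurable]:
  assumes [measurable]: "f \<in> borel_measurable borel"
  shows "wtensor f \<in> borel_measurable borel"
  unfolding wtensor_def by measurable

lemma nn_integral_wtensor_le:
  assumes f: "f \<in> L2_fun" and \<rho>: "0 < \<rho>"
  shows "(\<integral>\<^sup>+p. ennreal ((cmod (wtensor f p))\<^sup>2 / jac p) \<partial>lborel)
    \<le> ennreal (1 / 2 * ((L2_norm f)\<^sup>2
          - \<rho>\<^sup>2 / (2 * (1 + \<rho>\<^sup>2)) * (LINT y:{y. \<rho> \<le> norm y}|lborel. (cmod (f y))\<^sup>2)) * (L2_norm f)\<^sup>2)"
proof -
  note [measurable] = L2_fun_measurable[OF f]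
  define \<delta> where "\<delta> = \<rho>\<^sup>2 / (2 * (1 + \<rho>\<^sup>2))"
  have \<delta>: "0 \<le> \<delta>" "\<delta> \<le> 1" unfolding \<delta>_def by (rule gap_bounds)+
  define S where "S = {y :: real^2. \<rho> \<le> norm y}"
  have [measurable]: "S \<in> sets borel" unfolding S_def by measurable
  have int: "integrable lborel (\<lambda>y. (cmod (f y))\<^sup>2)" using f by (simp add: L2_fun_def)
  have intS: "integrable lborel (\<lambda>y. indicator S y *\<^sub>R (cmod (f y))\<^sup>2)"
    by (rule integrable_mult_indicator) (use int in auto)
  define g where "g y = (cmod (f y))\<^sup>2 * (1 - \<delta> * indicator S y)" for y
  have g: "0 \<le> g y" for y using \<delta> by (auto simp: g_def split: split_indicator)
  have geq: "g y = (cmod (f y))\<^sup>2 - \<delta> * (indicator S y *\<^sub>R (cmod (f y))\<^sup>2)" for y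
    by (simp add: g_def algebra_simps)
  have intg: "integrable lborel g" unfolding geq using int intS by auto
  have Ig: "integral\<^sup>L lborel g = (L2_norm f)\<^sup>2 - \<delta> * (LINT y:S|lborel. (cmod (f y))\<^sup>2)"
    unfolding geq using int intS
    by (simp add: L2_norm_def set_lebesgue_integral_def)
  have [measurable]: "g \<in> borel_measurable borel" using intg by auto
  have "(\<integral>\<^sup>+p. ennreal ((cmod (wtensor f p))\<^sup>2 / jac p) \<partial>lborel)
      = (\<integral>\<^sup>+y. \<integral>\<^sup>+y'. ennreal ((cmod (wtensor f (y, y')))\<^sup>2 / jac (y, y')) \<partial>lborel \<partial>lborel)"
    by (rule nn_integral_lborel_pair) measurable
  also have "\<dots> \<le> (\<integral>\<^sup>+y. \<integral>\<^sup>+y'. ennreal (1 / 2 * g y) * ennreal ((cmod (f y'))\<^sup>2) \<partial>lborel \<partial>lborel)"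
  proof (intro nn_integral_mono)
    fix y y'
    show "ennreal ((cmod (wtensor f (y, y')))\<^sup>2 / jac (y, y')) \<le> ennreal (1 / 2 * g y) * ennreal ((cmod (f y'))\<^sup>2)"
      using wtensor_sq_div_jac_le[OF \<rho>, of f y y'] g[of y]
      by (subst ennreal_mult[symmetric]) (auto simp: g_def \<delta>_def S_def intro!: ennreal_leI)
  qed
  also have "\<dots> = (\<integral>\<^sup>+y. ennreal (1 / 2 * g y) \<partial>lborel) * ennreal ((L2_norm f)\<^sup>2)"
    by (simp add: nn_integral_cmult nn_integral_multc nn_integral_L2_fun[OF f])
  also have "(\<integral>\<^sup>+y. ennreal (1 / 2 * g y) \<partial>lborel) = ennreal (1 / 2 * integral\<^sup>L lborel g)"
    using g intg by (subst nn_integral_eq_integral) auto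
  also have "ennreal (1 / 2 * integral\<^sup>L lborel g) * ennreal ((L2_norm f)\<^sup>2)
      = ennreal (1 / 2 * integral\<^sup>L lborel g * (L2_norm f)\<^sup>2)"
    using g by (simp add: ennreal_mult[symmetric] integral_nonneg_AE)
  finally show ?thesis unfolding Ig by (simp add: \<delta>_def S_def)
qed

lemma wtensor_finite:
  assumes "f \<in> L2_fun"
  shows "(\<integral>\<^sup>+p. ennreal ((cmod (wtensor f p))\<^sup>2 / jac p) \<partial>lborel) < top"
  using nn_integral_wtensor_le[OF assms, of 1] by (auto intro: le_less_trans)

lemma pushes_to_bound:
  assumes f: "f \<in> L2_fun" and push: "pushes_to (wtensor f) F" and \<rho>: "0 < \<rho>"
  shows "F \<in> L2_fun"
    and "(L2_norm F)\<^sup>2 \<le> pi / 2 * ((L2_norm f)\<^sup>2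
          - \<rho>\<^sup>2 / (2 * (1 + \<rho>\<^sup>2)) * (LINT y:{y. \<rho> \<le> norm y}|lborel. (cmod (f y))\<^sup>2)) * (L2_norm f)\<^sup>2"
proof -
  let ?c = "1 / 2 * ((L2_norm f)\<^sup>2
          - \<rho>\<^sup>2 / (2 * (1 + \<rho>\<^sup>2)) * (LINT y:{y. \<rho> \<le> norm y}|lborel. (cmod (f y))\<^sup>2)) * (L2_norm f)\<^sup>2"
  note [measurable] = L2_fun_measurable[OF f]
  have F [measurable]: "F \<in> borel_measurable borel" using push by (simp add: pushes_to_def)
  have "(\<integral>\<^sup>+q. ennreal ((cmod (F q))\<^sup>2) \<partial>lborel)
      \<le> ennreal pi * (\<integral>\<^sup>+p. ennreal ((cmod (wtensor f p))\<^sup>2 / jac p) \<partial>lborel)"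
    by (rule pushes_to_L2_bound[OF _ push]) measurable
  also have "\<dots> \<le> ennreal pi * ennreal ?c"
    by (intro mult_left_mono nn_integral_wtensor_le f \<rho>) simp
  \<comment> \<open>\<open>ennreal\<close> truncates at 0, so the bound carries
    \<open>max 0 ?c\<close> until the tail is shown to be at most the full squared norm, whence
    \<open>0 \<le> ?c\<close>.\<close>
  also have "\<dots> \<le> ennreal (pi * max 0 ?c)"
    by (subst ennreal_mult) (auto intro!: mult_left_mono ennreal_leI)
  finally have *: "(\<integral>\<^sup>+q. ennreal ((cmod (F q))\<^sup>2) \<partial>lborel) \<le> ennreal (pi * max 0 ?c)" .
  show FL: "F \<in> L2_fun" by (rule L2_funI(1)[OF F *]) simp
  have "set_integrable lborel {y. \<rho> \<le> norm y} (\<lambda>y. (cmod (f y))\<^sup>2)"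
    unfolding set_integrable_def using f
    by (intro integrable_mult_indicator) (auto simp: L2_fun_def)
  then have "(LINT y:{y. \<rho> \<le> norm y}|lborel. (cmod (f y))\<^sup>2) \<le> (L2_norm f)\<^sup>2"
    using f unfolding set_lebesgue_integral_def set_integrable_def
    by (simp add: L2_norm_def L2_fun_def) (rule integral_mono, auto split: split_indicator)
  moreover have "0 \<le> (LINT y:{y. \<rho> \<le> norm y}|lborel. (cmod (f y))\<^sup>2)"
    unfolding set_lebesgue_integral_def by (rule integral_nonneg_AE) simp
  moreover have "0 \<le> \<rho>\<^sup>2 / (2 * (1 + \<rho>\<^sup>2))" "\<rho>\<^sup>2 / (2 * (1 + \<rho>\<^sup>2)) \<le> 1"
    by (rule gap_bounds)+
  ultimately have "\<rho>\<^sup>2 / (2 * (1 + \<rho>\<^sup>2)) * (LINT y:{y. \<rho> \<le> norm y}|lborel. (cmod (f y))\<^sup>2) \<le> (L2_norm f)\<^sup>2"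
    by (meson mult_left_le_one_le order_trans)
  then have "0 \<le> ?c" by simp
  with L2_funI(2)[OF F *] show "(L2_norm F)\<^sup>2 \<le> pi / 2 * ((L2_norm f)\<^sup>2
          - \<rho>\<^sup>2 / (2 * (1 + \<rho>\<^sup>2)) * (LINT y:{y. \<rho> \<le> norm y}|lborel. (cmod (f y))\<^sup>2)) * (L2_norm f)\<^sup>2"
    by simp
qed

text \<open>For the implication from bounded sets to all square-integrable test functions no
  approximation is made: some F' with the stronger property exists, and uniqueness of densities
  identifies it with F almost everywhere.\<close>

lemma weighted_self_conv_iff_pushes_to:
  assumes f: "f \<in> L2_fun"
  shows "weighted_self_conv f F \<longleftrightarrow> pushes_to (wtensor f) F"
proof
  note [measurable] = L2_fun_measurable[OF f]
  let ?h = "\<lambda>y. f y * complex_of_real (sqrt (w y))"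
  have h: "?h \<in> borel_measurable borel" by measurable
  have imp: "weighted_self_conv f F" if "pushes_to (wtensor f) F" for F
    using pushes_to_imp_conv_density[OF h h, of F] that pushes_to_bound(1)[OF f that, of 1]
    by (simp add: weighted_self_conv_def wtensor_def[abs_def])
  then show "weighted_self_conv f F" if "pushes_to (wtensor f) F" using that .
  assume F: "weighted_self_conv f F"
  obtain F' where F': "pushes_to (wtensor f) F'"
    by (rule pushes_to_exists[OF _ wtensor_finite[OF f]]) auto
  have ae: "AE q in lborel. F' q = F q"
    using conv_density_unique[OF h h] F imp[OF F'] by (auto simp: weighted_self_conv_def)
  have [measurable]: "F \<in> borel_measurable borel" "F' \<in> borel_measurable borel"
    using F F' by (auto simp: weighted_self_conv_def pushes_to_def L2_fun_def)
  show "pushes_to (wtensor f) F"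
    unfolding pushes_to_def
  proof (intro conjI ballI)
    fix \<phi> :: "(real^2) \<times> real \<Rightarrow> complex" assume \<phi>: "\<phi> \<in> L2_fun"
    note [measurable] = L2_fun_measurable[OF \<phi>]
    have ae': "AE q in lborel. F' q * \<phi> q = F q * \<phi> q" using ae by eventually_elim simp
    show "integrable lborel (\<lambda>q. F q * \<phi> q)"
      using F' \<phi> integrable_cong_AE[OF _ _ ae'] by (simp add: pushes_to_def)
    show "(LINT q|lborel. F q * \<phi> q) = (LINT p|lborel. wtensor f p * \<phi> (sum_map p))"
      using F' \<phi> integral_cong_AE[OF _ _ ae'] by (simp add: pushes_to_def)
  qed (use F' in \<open>auto simp: pushes_to_def\<close>)
qed

lemma weighted_self_conv_exists:
  assumes f: "f \<in> L2_fun"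
  obtains F where "weighted_self_conv f F"
proof -
  note [measurable] = L2_fun_measurable[OF f]
  obtain F where "pushes_to (wtensor f) F"
    by (rule pushes_to_exists[OF _ wtensor_finite[OF f]]) auto
  with that show thesis by (simp add: weighted_self_conv_iff_pushes_to[OF f])
qed

section \<open>The lower bound\<close>

lemma nn_integral_exp_atLeast:
  fixes l :: real
  assumes l: "0 < l"
  shows "(\<integral>\<^sup>+t. ennreal (exp (- l * t)) * indicator {0..} t \<partial>lborel) = ennreal (1 / l)"
proof -
  have "(\<integral>\<^sup>+t. ennreal (exp (- l * t)) * indicator {0..} t \<partial>lborel) = ennreal (0 - (- exp (- l * 0) / l))"
  proof (rule nn_integral_FTC_atLeast)
    show "((\<lambda>t. - exp (- l * t) / l) has_real_derivative exp (- l * x)) (at x)" for x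
      using l by (auto intro!: derivative_eq_intros simp: field_simps)
    have "filterlim (\<lambda>t. - l * t) at_bot at_top"
      using l by (intro filterlim_tendsto_neg_mult_at_bot[OF tendsto_const]) (auto simp: filterlim_ident)
    then have "((\<lambda>t. exp (- l * t)) \<longlongrightarrow> 0) at_top"
      by (rule filterlim_compose[OF exp_at_bot])
    then have "((\<lambda>t. - exp (- l * t) / l) \<longlongrightarrow> - 0 / l) at_top"
      by (intro tendsto_intros) (use l in auto)
    then show "((\<lambda>t. - exp (- l * t) / l) \<longlongrightarrow> 0) at_top" by simp
  qed auto
  then show ?thesis by simp
qed

text \<open>The exponent carries 2 l because this is the square of
  \<open>exp (- l * phase y)\<close>, which is f \<surd>w for the test function f.\<close>

definition gauss :: "real \<Rightarrow> real^2 \<Rightarrow> real" where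
  "gauss l y = exp (- 2 * l * phase y)"

lemma measurable_gauss [measurable]: "gauss l \<in> borel_measurable borel"
  unfolding gauss_def by measurable

lemma gauss_pos: "0 < gauss l y"
  by (simp add: gauss_def)

text \<open>The fibre identity over \<xi> = 0 with \<open>exp (- l * \<tau>)\<close> for \<phi>:
  there y' = - y, \<open>jac\<close> is 2 + 4 |y|^2, and the phase sum is
  \<open>2 * phase y\<close>.\<close>

lemma nn_integral_gauss_identity:
  assumes l: "0 < l"
  shows "2 * (\<integral>\<^sup>+y. ennreal (gauss l y) \<partial>lborel) + 4 * (\<integral>\<^sup>+y. ennreal ((norm y)\<^sup>2 * gauss l y) \<partial>lborel)
    = ennreal (pi / l)"
proof -
  have j: "jac (z, - z) = 2 + 4 * (norm z)\<^sup>2" for z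
    using jac_centered[of 0 z] by simp
  have p: "phase z + phase (- z) = 2 * phase z" for z by (simp add: phase_def)
  have "(\<integral>\<^sup>+z. ennreal (jac (z, - z)) * ennreal (exp (- l * (phase z + phase (- z)))) \<partial>lborel)
      = ennreal pi * ennreal (1 / l)"
    using nn_integral_jac_fiber[of "\<lambda>t. ennreal (exp (- l * t))" 0] nn_integral_exp_atLeast[OF l] by simp
  also have "\<dots> = ennreal (pi / l)"
    using l by (simp add: ennreal_mult[symmetric])
  also have "(\<integral>\<^sup>+z. ennreal (jac (z, - z)) * ennreal (exp (- l * (phase z + phase (- z)))) \<partial>lborel)
      = (\<integral>\<^sup>+z. 2 * ennreal (gauss l z) + 4 * ennreal ((norm z)\<^sup>2 * gauss l z) \<partial>lborel)"
  proof (rule nn_integral_cong)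
    fix z :: "real^2"
    have "ennreal (jac (z, - z)) * ennreal (exp (- l * (phase z + phase (- z))))
        = ennreal (2 * gauss l z + 4 * ((norm z)\<^sup>2 * gauss l z))"
      unfolding j p by (subst ennreal_mult[symmetric]) (auto simp: gauss_def algebra_simps)
    also have "\<dots> = 2 * ennreal (gauss l z) + 4 * ennreal ((norm z)\<^sup>2 * gauss l z)"
      using gauss_pos[of l z] by (subst ennreal_plus) (auto simp: ennreal_mult' less_imp_le)
    finally show "ennreal (jac (z, - z)) * ennreal (exp (- l * (phase z + phase (- z)))) = \<dots>" .
  qed
  also have "\<dots> = 2 * (\<integral>\<^sup>+y. ennreal (gauss l y) \<partial>lborel) + 4 * (\<integral>\<^sup>+y. ennreal ((norm y)\<^sup>2 * gauss l y) \<partial>lborel)"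
    by (subst nn_integral_add) (auto simp: nn_integral_cmult)
  finally show ?thesis .
qed

text \<open>
  Since \<open>(norm y)\<^sup>2 \<le> phase y\<close> and \<open>l * phase y \<le> exp (l * phase y)\<close>, \<open>l * K\<close> is at most the mass of
  \<open>gauss (l / 2)\<close>, and the identity above controls that mass by \<open>pi / l = 2 * I + 4 * K\<close>.
\<close>

lemma gauss_moments:
  assumes l: "4 < l"
  obtains I K where "0 < I" "0 \<le> K" "(l - 4) * K \<le> 2 * I"
    "(\<integral>\<^sup>+y. ennreal (gauss l y) \<partial>lborel) = ennreal I"
    "(\<integral>\<^sup>+y. ennreal ((norm y)\<^sup>2 * gauss l y) \<partial>lborel) = ennreal K"
proof -
  let ?I = "\<lambda>l. \<integral>\<^sup>+y. ennreal (gauss l y) \<partial>lborel"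
    and ?K = "\<lambda>l. \<integral>\<^sup>+y. ennreal ((norm y)\<^sup>2 * gauss l y) \<partial>lborel"
  have id: "2 * ?I l + 4 * ?K l = ennreal (pi / l)" if "0 < l" for l
    by (rule nn_integral_gauss_identity[OF that])
  have reals: "\<exists>I K. 0 \<le> I \<and> 0 \<le> K \<and> ?I l = ennreal I \<and> ?K l = ennreal K \<and> 2 * I + 4 * K = pi / l"
    if l: "0 < l" for l
  proof -
    have "2 * ?I l + 4 * ?K l < top" unfolding id[OF l] by simp
    then have "?I l < top" "?K l < top" by (auto simp: ennreal_mult_less_top)
    then obtain I K where IK: "?I l = ennreal I" "0 \<le> I" "?K l = ennreal K" "0 \<le> K"
      by (cases "?I l" rule: ennreal_cases; cases "?K l" rule: ennreal_cases) auto
    have "ennreal (2 * I + 4 * K) = 2 * ?I l + 4 * ?K l"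
      using IK by (simp add: ennreal_mult ennreal_plus)
    also have "\<dots> = ennreal (pi / l)" by (rule id[OF l])
    finally have "2 * I + 4 * K = pi / l"
      using IK l by (subst (asm) ennreal_inj) auto
    with IK show ?thesis by blast
  qed
  obtain I K where IK: "0 \<le> I" "0 \<le> K" "?I l = ennreal I" "?K l = ennreal K" "2 * I + 4 * K = pi / l"
    using reals[of l] l by auto
  obtain I' K' where IK': "0 \<le> I'" "0 \<le> K'" "?I (l/2) = ennreal I'" "2 * I' + 4 * K' = pi / (l / 2)"
    using reals[of "l / 2"] l by auto
  have "ennreal K \<le> (\<integral>\<^sup>+y. ennreal (1 / l) * ennreal (gauss (l / 2) y) \<partial>lborel)"
    unfolding IK(4)[symmetric]
  proof (rule nn_integral_mono)
    fix y :: "real^2"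
    have "l * phase y \<le> exp (l * phase y)"
      using exp_ge_add_one_self[of "l * phase y"] by linarith
    then have "l * phase y * exp (- 2 * l * phase y) \<le> exp (l * phase y) * exp (- 2 * l * phase y)"
      by (rule mult_right_mono) simp
    also have "\<dots> = gauss (l / 2) y" by (simp add: gauss_def flip: exp_add)
    finally have "phase y * gauss l y \<le> 1 / l * gauss (l / 2) y"
      using l by (simp add: gauss_def field_simps)
    moreover have "(norm y)\<^sup>2 * gauss l y \<le> phase y * gauss l y"
      using gauss_pos[of l y] by (intro mult_right_mono) (auto simp: phase_def less_imp_le)
    ultimately show "ennreal ((norm y)\<^sup>2 * gauss l y) \<le> ennreal (1 / l) * ennreal (gauss (l / 2) y)"
      using l gauss_pos[of "l/2" y] by (subst ennreal_mult[symmetric]) (auto intro!: ennreal_leI)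
  qed
  also have "\<dots> = ennreal (1 / l * I')"
    using l IK' by (simp add: nn_integral_cmult ennreal_mult[symmetric])
  finally have "K \<le> 1 / l * I'" using l IK' by simp
  then have "l * K \<le> I'" using l by (simp add: field_simps)
  also have "I' \<le> pi / l"
  proof -
    define x where "x = pi / l"
    have "pi / (l / 2) = 2 * x" by (simp add: x_def)
    with IK'(4) have "2 * I' + 4 * K' = 2 * x" by (simp only:)
    with IK'(2) show ?thesis unfolding x_def[symmetric] by linarith
  qed
  finally have K: "l * K \<le> 2 * I + 4 * K" unfolding IK(5) .
  \<comment> \<open>If I vanished, l > 4 would force K = 0 as well, against
    \<open>2 * I + 4 * K = pi / l\<close>.\<close>
  have "I \<noteq> 0"
  proof
    assume "I = 0"
    with K have "(l - 4) * K \<le> 0" by (simp add: algebra_simps)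
    with l IK(2) have "K = 0" by (simp add: mult_le_0_iff)
    with \<open>I = 0\<close> IK(5) l show False by simp
  qed
  with IK K show thesis by (intro that[of I K]) (auto simp: algebra_simps)
qed

section \<open>Testing the inequality\<close>

lemma norm_add_sq_le:
  fixes y y' :: "'a::real_inner"
  shows "(norm (y + y'))\<^sup>2 \<le> 2 * ((norm y)\<^sup>2 + (norm y')\<^sup>2)"
proof -
  have "(norm (y + y'))\<^sup>2 + (norm (y - y'))\<^sup>2 = 2 * ((norm y)\<^sup>2 + (norm y')\<^sup>2)"
    by (simp add: power2_norm_eq_inner inner_add inner_diff inner_commute)
  then show ?thesis by (smt (verit) zero_le_power2)
qed

text \<open>Midpoint convexity of \<open>phase\<close>. It lets test functions be cut off to
  \<open>conv_supp\<close> without changing their composition with \<open>sum_map\<close>.\<close>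

lemma sum_map_in_conv_supp: "sum_map p \<in> conv_supp"
proof -
  obtain y y' where p: "p = (y, y')" by (cases p)
  define s where "s = (norm y)\<^sup>2 + (norm y')\<^sup>2"
  have le: "(norm (y + y'))\<^sup>2 \<le> 2 * s" unfolding s_def by (rule norm_add_sq_le)
  have "((norm (y + y'))\<^sup>2)\<^sup>2 \<le> (2 * s)\<^sup>2" by (rule power_mono[OF le]) simp
  also have "\<dots> \<le> 8 * (((norm y)\<^sup>2)\<^sup>2 + ((norm y')\<^sup>2)\<^sup>2)"
    using sum_squares_bound[of "(norm y)\<^sup>2" "(norm y')\<^sup>2"] unfolding s_def
    by (simp add: power2_sum algebra_simps)
  finally have "norm (y + y') ^ 4 \<le> 8 * (norm y ^ 4 + norm y' ^ 4)" by simp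
  with le show ?thesis by (simp add: p conv_supp_def sum_map_def phase_def s_def)
qed

text \<open>The difference of squared norms is the inner product of y - y' and y + y', so
  Cauchy--Schwarz cancels |y - y'|^2 and leaves |y + y'|^2, at most twice the sum of squares. For y
  = y' the quotient is 0 by convention.\<close>

lemma jac_le: "jac p \<le> 2 + 6 * ((norm (fst p))\<^sup>2 + (norm (snd p))\<^sup>2)"
proof -
  obtain y y' where p: "p = (y, y')" by (cases p)
  define s where "s = (norm y)\<^sup>2 + (norm y')\<^sup>2"
  have le: "(norm (y + y'))\<^sup>2 \<le> 2 * s" unfolding s_def by (rule norm_add_sq_le)
  have "(norm y)\<^sup>2 - (norm y')\<^sup>2 = (y - y') \<bullet> (y + y')"
    by (simp add: power2_norm_eq_inner inner_add inner_diff inner_commute)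
  then have "((norm y)\<^sup>2 - (norm y')\<^sup>2)\<^sup>2 \<le> (norm (y - y'))\<^sup>2 * (norm (y + y'))\<^sup>2"
    using Cauchy_Schwarz_ineq[of "y - y'" "y + y'"] by (simp add: power2_norm_eq_inner)
  then have "((norm y)\<^sup>2 - (norm y')\<^sup>2)\<^sup>2 / (norm (y - y'))\<^sup>2 \<le> (norm (y + y'))\<^sup>2"
    by (cases "y = y'") (simp_all add: divide_le_eq mult.commute)
  with le show ?thesis by (simp add: p jac_def s_def)
qed

lemma L2_Cauchy_Schwarz:
  fixes F \<phi> :: "'a::euclidean_space \<Rightarrow> complex"
  assumes F: "F \<in> L2_fun" and \<phi>: "\<phi> \<in> L2_fun" and int: "integrable lborel (\<lambda>q. F q * \<phi> q)"
  shows "(cmod (LINT q|lborel. F q * \<phi> q))\<^sup>2 \<le> (L2_norm F)\<^sup>2 * (L2_norm \<phi>)\<^sup>2"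
proof -
  note [measurable] = L2_fun_measurable[OF F] L2_fun_measurable[OF \<phi>]
  have "ennreal (cmod (LINT q|lborel. F q * \<phi> q)) \<le> (\<integral>\<^sup>+q. ennreal (cmod (F q)) * ennreal (cmod (\<phi> q)) \<partial>lborel)"
    using integral_norm_bound_ennreal[OF int] by (simp add: norm_mult ennreal_mult)
  then have "(ennreal (cmod (LINT q|lborel. F q * \<phi> q)))\<^sup>2
      \<le> (\<integral>\<^sup>+q. ennreal (cmod (F q)) * ennreal (cmod (\<phi> q)) \<partial>lborel)\<^sup>2"
    by (rule power_mono) simp
  also have "\<dots> \<le> (\<integral>\<^sup>+q. (ennreal (cmod (F q)))\<^sup>2 \<partial>lborel) * (\<integral>\<^sup>+q. (ennreal (cmod (\<phi> q)))\<^sup>2 \<partial>lborel)"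
    by (rule nn_integral_Cauchy_Schwarz) measurable
  also have "\<dots> = ennreal ((L2_norm F)\<^sup>2 * (L2_norm \<phi>)\<^sup>2)"
    by (simp add: ennreal_power nn_integral_L2_fun F \<phi> ennreal_mult)
  finally show ?thesis by (simp add: ennreal_power)
qed

text \<open>
  The test function \<open>f = exp (- l * phase) / \<surd>w\<close> makes \<open>wtensor f\<close> a function of \<open>sum_map\<close> alone, so that
  Cauchy--Schwarz against \<open>\<phi>\<close> loses only the variation of \<open>jac\<close>, which tends to \<open>2\<close> at the origin.
\<close>

lemma conv_inequality_test:
  assumes C: "conv_inequality C" and l: "4 < l"
  shows "pi * (l - 4) \<le> C ^ 4 * (2 * (l - 4) + 24)"
proof -
  obtain I K where IK: "0 < I" "0 \<le> K" "(l - 4) * K \<le> 2 * I"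
    and I: "(\<integral>\<^sup>+y. ennreal (gauss l y) \<partial>lborel) = ennreal I"
    and K: "(\<integral>\<^sup>+y. ennreal ((norm y)\<^sup>2 * gauss l y) \<partial>lborel) = ennreal K"
    by (rule gauss_moments[OF l])
  define f where "f y = complex_of_real (exp (- l * phase y) / sqrt (w y))" for y
  have [measurable]: "f \<in> borel_measurable borel" unfolding f_def by measurable
  have gauss_sq: "(exp (- (l * phase y)))\<^sup>2 = gauss l y" for y
    by (simp add: gauss_def power2_eq_square flip: exp_add)
  have f_sq: "(cmod (f y))\<^sup>2 \<le> gauss l y" for y
  proof -
    have "(cmod (f y))\<^sup>2 = gauss l y / w y"
      using w_pos[of y] by (simp add: f_def norm_divide power_divide gauss_sq less_imp_le)
    also have "\<dots> \<le> gauss l y / 1"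
      using gauss_pos[of l y] by (intro frac_le) (auto simp: w_eq_sqrt)
    finally show ?thesis by simp
  qed
  have "(\<integral>\<^sup>+y. ennreal ((cmod (f y))\<^sup>2) \<partial>lborel) \<le> ennreal I"
    unfolding I[symmetric] by (intro nn_integral_mono ennreal_leI f_sq)
  note f = L2_funI[OF _ this less_imp_le[OF IK(1)]]
  have fL: "f \<in> L2_fun" and fI: "(L2_norm f)\<^sup>2 \<le> I" by (rule f; simp)+
  obtain F where F: "weighted_self_conv f F" and FC: "L2_norm F \<le> C\<^sup>2 * (L2_norm f)\<^sup>2"
    using C fL by (auto simp: conv_inequality_def)
  have FL: "F \<in> L2_fun" using F by (simp add: weighted_self_conv_def)
  have push: "pushes_to (wtensor f) F" using F weighted_self_conv_iff_pushes_to[OF fL] by simp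
  have wt: "wtensor f p = complex_of_real (exp (- l * snd (sum_map p)))" for p
  proof -
    have fw: "f y * complex_of_real (sqrt (w y)) = complex_of_real (exp (- l * phase y))" for y
      using w_pos[of y] by (simp add: f_def)
    show ?thesis
      unfolding wtensor_def fw of_real_mult[symmetric] exp_add[symmetric]
      by (simp add: sum_map_def algebra_simps)
  qed

  \<comment> \<open>The exponential alone grows as the last coordinate tends to minus infinity; the
    cut-off removes this region.\<close>
  define \<phi> where "\<phi> q = complex_of_real (exp (- l * snd q)) * indicator conv_supp q"
    for q :: "(real^2) \<times> real"
  have [measurable]: "\<phi> \<in> borel_measurable borel" unfolding \<phi>_def by measurable
  have sq: "exp (- l * snd (sum_map p)) * exp (- l * snd (sum_map p)) = gauss l (fst p) * gauss l (snd p)" for p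
    by (simp add: gauss_def sum_map_def algebra_simps flip: exp_add)
  have \<phi>T: "\<phi> (sum_map p) = complex_of_real (exp (- l * snd (sum_map p)))" for p
    by (simp add: \<phi>_def sum_map_in_conv_supp)
  \<comment> \<open>The push-forward identity turns the norm of \<phi> into a double integral of
    \<open>jac\<close> against two copies of \<open>gauss l\<close>; \<open>jac_le\<close> then
    bounds it through the moments I and K.\<close>
  have "ennreal pi * (\<integral>\<^sup>+q. ennreal ((cmod (\<phi> q))\<^sup>2) \<partial>lborel)
      = ennreal pi * (\<integral>\<^sup>+q. ennreal ((cmod (\<phi> q))\<^sup>2) * indicator conv_supp q \<partial>lborel)"
    by (intro arg_cong2[where f="(*)"] refl nn_integral_cong) (auto simp: \<phi>_def split: split_indicator)
  also have "\<dots> = (\<integral>\<^sup>+p. ennreal (jac p) * ennreal ((cmod (\<phi> (sum_map p)))\<^sup>2) \<partial>lborel)"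
    by (rule nn_integral_jac_sum_map[symmetric]) measurable
  also have "\<dots> = (\<integral>\<^sup>+p. ennreal (jac p) * ennreal (gauss l (fst p) * gauss l (snd p)) \<partial>lborel)"
    unfolding \<phi>T norm_of_real abs_exp_cancel power2_eq_square sq ..
  also have "\<dots> = (\<integral>\<^sup>+y. \<integral>\<^sup>+y'. ennreal (jac (y, y')) * ennreal (gauss l y * gauss l y') \<partial>lborel \<partial>lborel)"
    by (subst nn_integral_lborel_pair) auto
  also have "\<dots> \<le> (\<integral>\<^sup>+y. \<integral>\<^sup>+y'. ennreal (2 * gauss l y + 6 * ((norm y)\<^sup>2 * gauss l y)) * ennreal (gauss l y')
      + ennreal (6 * gauss l y) * ennreal ((norm y')\<^sup>2 * gauss l y') \<partial>lborel \<partial>lborel)"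
  proof (intro nn_integral_mono)
    fix y y'
    have "jac (y, y') * (gauss l y * gauss l y')
        \<le> (2 + 6 * ((norm y)\<^sup>2 + (norm y')\<^sup>2)) * (gauss l y * gauss l y')"
      using jac_le[of "(y, y')"] gauss_pos[of l y] gauss_pos[of l y'] by (intro mult_right_mono) auto
    also have "\<dots> = (2 * gauss l y + 6 * ((norm y)\<^sup>2 * gauss l y)) * gauss l y'
        + 6 * gauss l y * ((norm y')\<^sup>2 * gauss l y')" by (simp add: algebra_simps)
    finally have "ennreal (jac (y, y') * (gauss l y * gauss l y')) \<le> ennreal \<dots>" by (rule ennreal_leI)
    then show "ennreal (jac (y, y')) * ennreal (gauss l y * gauss l y')
      \<le> ennreal (2 * gauss l y + 6 * ((norm y)\<^sup>2 * gauss l y)) * ennreal (gauss l y')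
        + ennreal (6 * gauss l y) * ennreal ((norm y')\<^sup>2 * gauss l y')"
      using jac_ge_2[of "(y, y')"] gauss_pos[of l y] gauss_pos[of l y']
      by (simp add: ennreal_mult[symmetric] ennreal_plus[symmetric] del: ennreal_plus)
  qed
  also have "\<dots> = (\<integral>\<^sup>+y. ennreal (2 * I + 6 * K) * ennreal (gauss l y)
      + ennreal (6 * I) * ennreal ((norm y)\<^sup>2 * gauss l y) \<partial>lborel)"
  proof (rule nn_integral_cong)
    fix y
    have "(\<integral>\<^sup>+y'. ennreal (2 * gauss l y + 6 * ((norm y)\<^sup>2 * gauss l y)) * ennreal (gauss l y')
        + ennreal (6 * gauss l y) * ennreal ((norm y')\<^sup>2 * gauss l y') \<partial>lborel)
      = ennreal (2 * gauss l y + 6 * ((norm y)\<^sup>2 * gauss l y)) * ennreal I + ennreal (6 * gauss l y) * ennreal K"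
      by (subst nn_integral_add) (auto simp: nn_integral_cmult I K)
    also have "\<dots> = ennreal ((2 * gauss l y + 6 * ((norm y)\<^sup>2 * gauss l y)) * I + 6 * gauss l y * K)"
      using IK gauss_pos[of l y] by (simp add: ennreal_mult[symmetric] ennreal_plus[symmetric] del: ennreal_plus)
    also have "(2 * gauss l y + 6 * ((norm y)\<^sup>2 * gauss l y)) * I + 6 * gauss l y * K
        = (2 * I + 6 * K) * gauss l y + 6 * I * ((norm y)\<^sup>2 * gauss l y)"
      by (simp add: algebra_simps)
    also have "ennreal \<dots> = ennreal (2 * I + 6 * K) * ennreal (gauss l y)
        + ennreal (6 * I) * ennreal ((norm y)\<^sup>2 * gauss l y)"
      using IK gauss_pos[of l y] by (simp add: ennreal_mult[symmetric] ennreal_plus[symmetric] del: ennreal_plus)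
    finally show "(\<integral>\<^sup>+y'. ennreal (2 * gauss l y + 6 * ((norm y)\<^sup>2 * gauss l y)) * ennreal (gauss l y')
        + ennreal (6 * gauss l y) * ennreal ((norm y')\<^sup>2 * gauss l y') \<partial>lborel) = \<dots>" .
  qed
  also have "\<dots> = ennreal (2 * I + 6 * K) * ennreal I + ennreal (6 * I) * ennreal K"
    by (subst nn_integral_add) (auto simp: nn_integral_cmult I K)
  also have "\<dots> = ennreal ((2 * I + 6 * K) * I + 6 * I * K)"
    using IK by (simp add: ennreal_mult[symmetric] ennreal_plus[symmetric] del: ennreal_plus)
  also have "(2 * I + 6 * K) * I + 6 * I * K = pi * (I * (2 * I + 12 * K) / pi)"
    by (simp add: field_simps)
  also have "ennreal \<dots> = ennreal pi * ennreal (I * (2 * I + 12 * K) / pi)"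
    using IK by (intro ennreal_mult) auto
  finally have "(\<integral>\<^sup>+q. ennreal ((cmod (\<phi> q))\<^sup>2) \<partial>lborel) \<le> ennreal (I * (2 * I + 12 * K) / pi)"
    by (subst (asm) ennreal_mult_le_mult_iff) auto
  note \<phi> = L2_funI[OF _ this]
  have \<phi>L: "\<phi> \<in> L2_fun" and \<phi>I: "(L2_norm \<phi>)\<^sup>2 \<le> I * (2 * I + 12 * K) / pi"
    by (rule \<phi>; use IK in simp)+

  \<comment> \<open>Both factors equal the same exponential along \<open>sum_map\<close>, so the
    pairing is the product of two masses I.\<close>
  have "(LINT q|lborel. F q * \<phi> q) = (LINT p|lborel. wtensor f p * \<phi> (sum_map p))"
    using push \<phi>L by (simp add: pushes_to_def)
  also have "\<dots> = (LINT p|lborel. complex_of_real (gauss l (fst p) * gauss l (snd p)))"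
    unfolding wt \<phi>T of_real_mult[symmetric] sq ..
  also have "\<dots> = complex_of_real (LINT p|lborel. gauss l (fst p) * gauss l (snd p))"
    by (rule integral_complex_of_real)
  also have "(LINT p|lborel. gauss l (fst p) * gauss l (snd p)) = I * I"
  proof (intro integral_eq_nn_integral[THEN trans])
    have "(\<integral>\<^sup>+p. ennreal (gauss l (fst p) * gauss l (snd p)) \<partial>lborel)
        = (\<integral>\<^sup>+y. \<integral>\<^sup>+y'. ennreal (gauss l y) * ennreal (gauss l y') \<partial>lborel \<partial>lborel)"
      using gauss_pos by (subst nn_integral_lborel_pair) (auto simp: ennreal_mult less_imp_le)
    also have "\<dots> = ennreal (I * I)"
      using IK by (simp add: nn_integral_cmult nn_integral_multc I ennreal_mult)
    finally show "enn2real (\<integral>\<^sup>+p. ennreal (gauss l (fst p) * gauss l (snd p)) \<partial>lborel) = I * I"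
      using IK by simp
  qed (use gauss_pos in \<open>auto simp: less_imp_le\<close>)
  finally have "(cmod (LINT q|lborel. F q * \<phi> q))\<^sup>2 = I ^ 4"
    using IK by (simp add: norm_mult power_mult_distrib flip: power_add of_real_mult)
  then have "I ^ 4 \<le> (L2_norm F)\<^sup>2 * (L2_norm \<phi>)\<^sup>2"
    using L2_Cauchy_Schwarz[OF FL \<phi>L] push \<phi>L by (auto simp: pushes_to_def)
  also have "\<dots> \<le> (C\<^sup>2 * I)\<^sup>2 * (I * (2 * I + 12 * K) / pi)"
  proof (intro mult_mono \<phi>I power_mono)
    show "L2_norm F \<le> C\<^sup>2 * I" using FC fI by (meson mult_left_mono order_trans zero_le_power2)
    show "0 \<le> L2_norm F" by (simp add: L2_norm_def)
  qed auto
  finally have "pi * I * I ^ 3 \<le> C ^ 4 * (2 * I + 12 * K) * I ^ 3"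
    by (simp add: field_simps eval_nat_numeral)
  then have *: "pi * I \<le> C ^ 4 * (2 * I + 12 * K)" using IK by simp
  have "pi * (l - 4) * I \<le> C ^ 4 * ((2 * I + 12 * K) * (l - 4))"
    using mult_right_mono[OF *, of "l - 4"] l by (simp add: ac_simps)
  \<comment> \<open>The moment bound \<open>(l - 4) * K \<le> 2 * I\<close> turns
    \<open>12 * K * (l - 4)\<close> into at most \<open>24 * I\<close>, after which I
    cancels.\<close>
  also have "\<dots> \<le> C ^ 4 * ((2 * (l - 4) + 24) * I)"
  proof (rule mult_left_mono)
    have "(2 * I + 12 * K) * (l - 4) = 2 * (l - 4) * I + 12 * ((l - 4) * K)" by (simp add: algebra_simps)
    also have "\<dots> \<le> 2 * (l - 4) * I + 12 * (2 * I)" using IK(3) by linarith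
    finally show "(2 * I + 12 * K) * (l - 4) \<le> (2 * (l - 4) + 24) * I" by (simp add: algebra_simps)
  qed simp
  finally have "pi * (l - 4) * I \<le> C ^ 4 * (2 * (l - 4) + 24) * I" by (simp add: ac_simps)
  then show ?thesis using IK by (subst (asm) mult_le_cancel_right_pos) auto
qed

text \<open>Dividing the tested inequality by l - 4 leaves an error 24 / (l - 4), which disappears
  along l = 4 + (n + 1).\<close>

lemma conv_inequality_ge:
  assumes "conv_inequality C"
  shows "pi / 2 \<le> C ^ 4"
proof -
  have lim: "(\<lambda>n. C ^ 4 * (2 + 24 * (1 / real (Suc n)))) \<longlonglongrightarrow> C ^ 4 * (2 + 24 * 0)"
    by (intro tendsto_intros LIMSEQ_inverse_real_of_nat[unfolded inverse_eq_divide])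
  have "pi \<le> C ^ 4 * (2 + 24 * (1 / real (Suc n)))" for n
    using conv_inequality_test[OF assms, of "4 + real (Suc n)"] by (simp add: field_simps)
  then have "pi \<le> C ^ 4 * (2 + 24 * 0)" by (intro LIMSEQ_le_const[OF lim]) blast
  then show ?thesis by simp
qed

section \<open>The sharp constant\<close>

lemma weighted_self_conv_bound:
  assumes "f \<in> L2_fun" "weighted_self_conv f F" "0 < \<rho>"
  shows "(L2_norm F)\<^sup>2 \<le> pi / 2 * ((L2_norm f)\<^sup>2
          - \<rho>\<^sup>2 / (2 * (1 + \<rho>\<^sup>2)) * (LINT y:{y. \<rho> \<le> norm y}|lborel. (cmod (f y))\<^sup>2)) * (L2_norm f)\<^sup>2"
  using pushes_to_bound(2) weighted_self_conv_iff_pushes_to assms by blast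

lemma tail_nonneg: "0 \<le> (LINT y:S|lborel. (cmod (f y))\<^sup>2)"
  unfolding set_lebesgue_integral_def by (rule integral_nonneg_AE) simp

lemma conv_inequality_pi_half: "conv_inequality (root 4 (pi / 2))"
  unfolding conv_inequality_def
proof
  fix f :: "real^2 \<Rightarrow> complex" assume f: "f \<in> L2_fun"
  obtain F where F: "weighted_self_conv f F" by (rule weighted_self_conv_exists[OF f])
  \<comment> \<open>The radius 1 is an arbitrary choice, since the tail term is dropped in the next
    step.\<close>
  have "(L2_norm F)\<^sup>2 \<le> pi / 2 * ((L2_norm f)\<^sup>2
      - 1\<^sup>2 / (2 * (1 + 1\<^sup>2)) * (LINT y:{y. 1 \<le> norm y}|lborel. (cmod (f y))\<^sup>2)) * (L2_norm f)\<^sup>2"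
    by (rule weighted_self_conv_bound[OF f F]) simp
  also have "\<dots> \<le> pi / 2 * (L2_norm f)\<^sup>2 * (L2_norm f)\<^sup>2"
    by (intro mult_right_mono mult_left_mono) (simp_all add: tail_nonneg)
  also have "\<dots> = ((root 4 (pi / 2))\<^sup>2 * (L2_norm f)\<^sup>2)\<^sup>2"
  proof -
    have "((root 4 (pi / 2))\<^sup>2)\<^sup>2 = pi / 2"
      using real_root_pow_pos2[of 4 "pi / 2"] by (simp flip: power_mult)
    then show ?thesis by (simp add: power_mult_distrib power2_eq_square[of "(L2_norm f)\<^sup>2"])
  qed
  finally have "L2_norm F \<le> (root 4 (pi / 2))\<^sup>2 * (L2_norm f)\<^sup>2"
    by (rule power2_le_imp_le) simp
  with F show "\<exists>F. weighted_self_conv f F \<and> L2_norm F \<le> (root 4 (pi / 2))\<^sup>2 * (L2_norm f)\<^sup>2" by blast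
qed

lemma best_const_eq: "best_const = root 4 (pi / 2)"
  unfolding best_const_def
proof (rule cInf_eq_minimum)
  show "root 4 (pi / 2) \<in> {C. 0 \<le> C \<and> conv_inequality C}"
    using conv_inequality_pi_half by (simp add: real_root_ge_zero)
  fix C assume C: "C \<in> {C. 0 \<le> C \<and> conv_inequality C}"
  then have "root 4 (pi / 2) \<le> root 4 (C ^ 4)"
    by (intro real_root_le_mono conv_inequality_ge) auto
  with C show "root 4 (pi / 2) \<le> C" by (simp add: real_root_power_cancel)
qed

lemma best_const_pow4: "best_const ^ 4 = pi / 2"
  unfolding best_const_eq by (rule real_root_pow_pos2) auto

text \<open>Equality leaves no room for the gain, so the tail mass is zero for every positive
  \<rho>. Letting \<rho> run through 1 / (n + 1), f vanishes almost everywhere off the origin, which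
  is itself a null set.\<close>

lemma no_extremizer: "\<not> extremizer f"
proof
  assume "extremizer f"
  then obtain F where f: "f \<in> L2_fun" and nz: "\<not> (AE y in lborel. f y = 0)"
    and F: "weighted_self_conv f F" and eq: "L2_norm F = best_const\<^sup>2 * (L2_norm f)\<^sup>2"
    by (auto simp: extremizer_def)
  note [measurable] = L2_fun_measurable[OF f]
  define N where "N = (L2_norm f)\<^sup>2"
  have "N \<noteq> 0"
  proof
    assume "N = 0"
    then have "(\<integral>\<^sup>+y. ennreal ((cmod (f y))\<^sup>2) \<partial>lborel) = 0"
      using nn_integral_L2_fun[OF f] by (simp add: N_def)
    then have "AE y in lborel. f y = 0" by (subst (asm) nn_integral_0_iff_AE) auto
    with nz show False ..
  qed
  then have N: "0 < N" by (simp add: N_def)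
  have "(L2_norm F)\<^sup>2 = best_const ^ 4 * N\<^sup>2"
    by (simp add: eq N_def power_mult_distrib flip: power_mult)
  then have F2: "(L2_norm F)\<^sup>2 = pi / 2 * N\<^sup>2" by (simp only: best_const_pow4)
  have ae: "AE y in lborel. \<rho> \<le> norm y \<longrightarrow> f y = 0" if \<rho>: "0 < \<rho>" for \<rho>
  proof -
    define m where "m = (LINT y:{y. \<rho> \<le> norm y}|lborel. (cmod (f y))\<^sup>2)"
    have "pi / 2 * N * N \<le> pi / 2 * (N - \<rho>\<^sup>2 / (2 * (1 + \<rho>\<^sup>2)) * m) * N"
      using weighted_self_conv_bound[OF f F \<rho>] unfolding F2 N_def[symmetric] m_def[symmetric]
      by (simp add: power2_eq_square)
    then have "\<rho>\<^sup>2 / (2 * (1 + \<rho>\<^sup>2)) * m \<le> 0"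
      using N by simp
    moreover have "0 < \<rho>\<^sup>2 / (2 * (1 + \<rho>\<^sup>2))"
      using \<rho> by (intro divide_pos_pos mult_pos_pos) (auto simp: add_pos_nonneg)
    ultimately have "m \<le> 0" by (simp only: mult_le_0_iff) linarith
    moreover have "0 \<le> m" unfolding m_def by (rule tail_nonneg)
    ultimately have "m = 0" by simp
    moreover have "integrable lborel (\<lambda>y. indicator {y. \<rho> \<le> norm y} y *\<^sub>R (cmod (f y))\<^sup>2)"
      using f by (intro integrable_mult_indicator) (auto simp: L2_fun_def)
    ultimately have "AE y in lborel. indicator {y. \<rho> \<le> norm y} y *\<^sub>R (cmod (f y))\<^sup>2 = 0"
      unfolding m_def set_lebesgue_integral_def
      by (subst (asm) integral_nonneg_eq_0_iff_AE) auto
    then show ?thesis by eventually_elim auto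
  qed
  have "AE y in lborel. \<forall>n. 1 / real (Suc n) \<le> norm y \<longrightarrow> f y = 0"
    unfolding AE_all_countable by (intro allI ae) simp
  moreover have "AE y in lborel. y \<noteq> (0 :: real^2)" by (rule AE_lborel_singleton)
  ultimately have "AE y in lborel. f y = 0"
  proof eventually_elim
    case (elim y)
    then obtain n where "inverse (real (Suc n)) < norm y" using reals_Archimedean[of "norm y"] by auto
    with elim show ?case by (auto simp: inverse_eq_divide intro: less_imp_le)
  qed
  with nz show False ..
qed

text \<open>A tail of at least \<epsilon> times the squared norm would keep the squared norm of the
  convolution at or below (1 - e) pi / 2, away from its limit pi / 2. The same contradiction covers
  members of norm zero, so the strict inequality holds for all large n.\<close>

lemma extremizing_seq_concentrates:
  assumes "extremizing_seq f"
  shows "concentrates_at_origin f"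
  unfolding concentrates_at_origin_def
proof (intro allI impI)
  fix \<epsilon> \<rho> :: real assume \<epsilon>: "0 < \<epsilon>" and \<rho>: "0 < \<rho>"
  obtain F where f: "\<And>n. f n \<in> L2_fun" and le1: "\<And>n. L2_norm (f n) \<le> 1"
    and F: "\<And>n. weighted_self_conv (f n) (F n)" and lim: "(\<lambda>n. L2_norm (F n)) \<longlonglongrightarrow> best_const\<^sup>2"
    using assms by (auto simp: extremizing_seq_def)
  define \<delta> where "\<delta> = \<rho>\<^sup>2 / (2 * (1 + \<rho>\<^sup>2))"
  have \<delta>: "0 < \<delta>" "\<delta> \<le> 1"
    using \<rho> gap_bounds(2) unfolding \<delta>_def
    by (auto simp: add_pos_nonneg intro!: divide_pos_pos mult_pos_pos)
  \<comment> \<open>Taking \<open>min \<epsilon> 1\<close> ensures e \<le> 1, so 1 - e is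
    nonnegative when \<open>N * N\<close> is replaced by 1 at the end.\<close>
  define e where "e = \<delta> * min \<epsilon> 1"
  have e: "0 < e" "e \<le> 1"
    using \<delta> \<epsilon> by (auto simp: e_def intro: mult_le_one)
  have "(\<lambda>n. (L2_norm (F n))\<^sup>2) \<longlonglongrightarrow> (best_const\<^sup>2)\<^sup>2"
    by (intro tendsto_intros lim)
  also have "(best_const\<^sup>2)\<^sup>2 = pi / 2"
    using best_const_pow4 by (simp flip: power_mult)
  finally have "\<forall>\<^sub>F n in sequentially. pi / 2 * (1 - e) < (L2_norm (F n))\<^sup>2"
    by (rule order_tendstoD) (use e in \<open>simp add: algebra_simps\<close>)
  then obtain n0 where n0: "\<And>n. n0 \<le> n \<Longrightarrow> pi / 2 * (1 - e) < (L2_norm (F n))\<^sup>2"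
    by (auto simp: eventually_sequentially)
  show "\<exists>N. \<forall>n\<ge>N. (LINT y:{y. \<rho> \<le> norm y}|lborel. (cmod (f n y))\<^sup>2) < \<epsilon> * (L2_norm (f n))\<^sup>2"
  proof (intro exI[of _ n0] allI impI, rule ccontr)
    fix n assume n: "n0 \<le> n"
    define N where "N = (L2_norm (f n))\<^sup>2"
    define m where "m = (LINT y:{y. \<rho> \<le> norm y}|lborel. (cmod (f n y))\<^sup>2)"
    have N: "0 \<le> N" "N \<le> 1"
      using le1[of n] by (auto simp: N_def L2_norm_def)
    assume "\<not> (LINT y:{y. \<rho> \<le> norm y}|lborel. (cmod (f n y))\<^sup>2) < \<epsilon> * (L2_norm (f n))\<^sup>2"
    then have "\<epsilon> * N \<le> m" by (simp add: N_def m_def)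
    moreover have "min \<epsilon> 1 * N \<le> \<epsilon> * N" using N by (intro mult_right_mono) auto
    ultimately have "\<delta> * (min \<epsilon> 1 * N) \<le> \<delta> * m" using \<delta> by (intro mult_left_mono) auto
    then have "N - \<delta> * m \<le> (1 - e) * N" by (simp add: e_def algebra_simps)
    have "pi / 2 * (1 - e) < (L2_norm (F n))\<^sup>2" by (rule n0[OF n])
    also have "\<dots> \<le> pi / 2 * (N - \<delta> * m) * N"
      using weighted_self_conv_bound[OF f F \<rho>, of n] by (simp add: N_def m_def \<delta>_def)
    also have "\<dots> \<le> pi / 2 * ((1 - e) * N) * N"
      using \<open>N - \<delta> * m \<le> (1 - e) * N\<close> N by (intro mult_right_mono mult_left_mono) auto
    also have "\<dots> = pi / 2 * (1 - e) * (N * N)" by simp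
    also have "\<dots> \<le> pi / 2 * (1 - e) * 1"
      using N e by (intro mult_left_mono mult_le_one) auto
    finally show False by simp
  qed
qed

theorem theorem1p7:
  shows "conv_inequality best_const \<and>
         best_const ^ 4 = pi / 2 \<and>
         (\<nexists>f. extremizer f) \<and>
         (\<forall>f. extremizing_seq f \<longrightarrow> concentrates_at_origin f)"
  using conv_inequality_pi_half best_const_pow4 no_extremizer extremizing_seq_concentrates
  by (simp add: best_const_eq)

end
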